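(* Assume (SA1) and (SA3) (see context) hold with $\eta(n)=A n^{-\psi}$, $\psi>1$, and (SA2) holds with $\alpha(n)=A'n^{-\gamma}$, $\gamma>0$, where $A,A'$ are constants. Then, for arbitrary $\delta>0$, as $n\to\infty$, $$|\sigma_n^2-\mathbb E\sigma_n^2|=\begin{cases} O(n^{-\frac12}\log^{\frac32+\delta}n), & \min\{\psi-1,\gamma\}>1,\\ O(n^{-\frac12+\delta}), & \min\{\psi-1,\gamma\}=1,\\ O(n^{-\frac{\min\{\psi-1,\gamma\}}2}\log^{\frac32+\delta}n), & 0<\min\{\psi-1,\gamma\}<1 \end{cases}$$ $\mathbb P$-almost surely.
   Context: Setting. $(\Omega_0,\mathcal E)$ and $(X,\mathcal B)$ are measurable spaces, $\mathbb Z_+=\{1,2,\dots\}$, $\mathbb N=\{0,1,\dots\}$, $\Omega=\Omega_0^{\mathbb Z_+}$ with product sigma-algebra $\mathcal F$, and $\mathbb P$ is a probability measure on $(\Omega,\mathcal F)$ (not assumed product or shift-invariant), with expectation $\mathbb E$. $\tau:\Omega\to\Omega$, $\tau(\omega_1,\omega_2,\dots)=(\omega_2,\omega_3,\dots)$ is the shift. For each $\omega_0\in\Omega_0$, $T_{\omega_0}:X\to X$ is measurable. Put $\varphi(n,\omega)=\varphi(n,\omega,\cdot)=T_{\omega_n}\circ\dots\circ T_{\omega_1}$, $\varphi(0,\omega)=\mathrm{id}_X$; for each $n$ the map $(\omega,x)\mapsto\varphi(n,\omega,x)$ is assumed measurable. $\mu$ is a probability measure on $(X,\mathcal B)$, $\mu(g)=\int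 g\,d\mu$, and $f:X\to\mathbb R$ is bounded measurable. Put $f_i=f\circ\varphi(i,\omega)$, $\bar f_i=f_i-\mu(f_i)$ and $\sigma_n^2=\sigma_n^2(\omega)=\frac1n\sum_{i=0}^{n-1}\sum_{j=0}^{n-1}\mu(\bar f_i\bar f_j)$. Here $\log^pn=(\log n)^p$. (SA1) There is a non-increasing $\eta:\mathbb N\to[0,\infty)$ with $\sum_i\eta(i)<\infty$ such that, for $\mathbb P$-almost every $\omega$, $|\mu(\bar f_i\bar f_j)|\le\eta(|i-j|)$ for all $i,j\ge0$. (SA2) There is a non-increasing sequence $(\alpha(n))_{n\ge1}$ with $\alpha(n)\to0$ and $\sup_{i\ge1}\sup\{|\mathbb P(A\cap B)-\mathbb P(A)\mathbb P(B)|: A\in\mathcal F_1^i,\ B\in\mathcal F_{i+n}^\infty\}\le\alpha(n)$ for all $n\ge1$, where $\mathcal F_i^j$ is the sigma-algebra generated by the coordinates $\omega_m$, $i\le m\le j$. (SA3) There is a constant $C\ge0$ such that, for $\mathbb P$-almost every $\omega$ and all $0\le r\le k$, $|\mu(g\circ\varphi(k,\omega))-\mu(g\circ\varphi(k-r,\tau^r\omega))|\le C\eta(k-r)$ for every $g\in\{f\circ\varphi(m,\tau^k\omega):m\ge0\}\cup\{f\cdot(f\circ\varphi(m,\tau^k\omega)):m\ge0\}$, with the same $\eta$ as in (SA1). Convention: $\eta(n)=An^{-\psi}$ is understood with $0^{-\psi}:=1$. *)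

theory Defs
  imports "HOL-Probability.Probability" "HOL-Library.Landau_Symbols"
begin

text \<open>
  A measurable space \<open>(\<Omega>\<^sub>0, \<E>)\<close> is represented by a measure \<open>E\<close> of which only \<open>space E\<close> and
  \<open>sets E\<close> are used.  Noise sequences \<open>\<omega> = (\<omega>\<^sub>1, \<omega>\<^sub>2, \<dots>)\<close> are the elements of
  \<open>PiE {1..} (\<lambda>_. space E)\<close>; in particular they are \<open>undefined\<close> at the unused index 0.
\<close>

definition shift :: "(nat \<Rightarrow> 'w) \<Rightarrow> nat \<Rightarrow> 'w" where
  "shift \<omega> = (\<lambda>i\<in>{1..}. \<omega> (Suc i))"

primrec cocycle :: "('w \<Rightarrow> 'x \<Rightarrow> 'x) \<Rightarrow> nat \<Rightarrow> (nat \<Rightarrow> 'w) \<Rightarrow> 'x \<Rightarrow> 'x" where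
  "cocycle T 0 \<omega> = id"
| "cocycle T (Suc n) \<omega> = T (\<omega> (Suc n)) \<circ> cocycle T n \<omega>"

locale random_dynamics =
  P: prob_space P + \<mu>: prob_space \<mu>
  for E :: "'w measure" and P :: "(nat \<Rightarrow> 'w) measure"
    and T :: "'w \<Rightarrow> 'x \<Rightarrow> 'x" and \<mu> :: "'x measure" and f :: "'x \<Rightarrow> real" +
  assumes sets_P: "sets P = sets (PiM {1..} (\<lambda>_. E))"
    and T_measurable: "w \<in> space E \<Longrightarrow> T w \<in> measurable \<mu> \<mu>"
    and cocycle_measurable:
      "(\<lambda>(\<omega>, x). cocycle T n \<omega> x) \<in> measurable (P \<Otimes>\<^sub>M \<mu>) \<mu>"
    and f_measurable: "f \<in> borel_measurable \<mu>"
    and f_bounded: "\<exists>K. \<forall>x\<in>space \<mu>. \<bar>f x\<bar> \<le> K"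

definition f_bar ::
    "('w \<Rightarrow> 'x \<Rightarrow> 'x) \<Rightarrow> 'x measure \<Rightarrow> ('x \<Rightarrow> real) \<Rightarrow> nat \<Rightarrow> (nat \<Rightarrow> 'w) \<Rightarrow> 'x \<Rightarrow> real" where
  "f_bar T \<mu> f i \<omega> x = f (cocycle T i \<omega> x) - (\<integral>y. f (cocycle T i \<omega> y) \<partial>\<mu>)"

definition covar ::
    "('w \<Rightarrow> 'x \<Rightarrow> 'x) \<Rightarrow> 'x measure \<Rightarrow> ('x \<Rightarrow> real) \<Rightarrow> nat \<Rightarrow> nat \<Rightarrow> (nat \<Rightarrow> 'w) \<Rightarrow> real" where
  "covar T \<mu> f i j \<omega> = (\<integral>x. f_bar T \<mu> f i \<omega> x * f_bar T \<mu> f j \<omega> x \<partial>\<mu>)"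

definition sigma_sq ::
    "('w \<Rightarrow> 'x \<Rightarrow> 'x) \<Rightarrow> 'x measure \<Rightarrow> ('x \<Rightarrow> real) \<Rightarrow> nat \<Rightarrow> (nat \<Rightarrow> 'w) \<Rightarrow> real" where
  "sigma_sq T \<mu> f n \<omega> = (1 / real n) * (\<Sum>i<n. \<Sum>j<n. covar T \<mu> f i j \<omega>)"

definition SA1 ::
    "(nat \<Rightarrow> 'w) measure \<Rightarrow> ('w \<Rightarrow> 'x \<Rightarrow> 'x) \<Rightarrow> 'x measure \<Rightarrow> ('x \<Rightarrow> real) \<Rightarrow> (nat \<Rightarrow> real) \<Rightarrow> bool" where
  "SA1 P T \<mu> f \<eta> \<longleftrightarrow>
     antimono \<eta> \<and> (\<forall>n. 0 \<le> \<eta> n) \<and> summable \<eta> \<and>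
     (AE \<omega> in P. \<forall>i j. \<bar>covar T \<mu> f i j \<omega>\<bar> \<le> \<eta> (nat \<bar>int i - int j\<bar>))"

definition coord_algebra :: "'w measure \<Rightarrow> nat set \<Rightarrow> (nat \<Rightarrow> 'w) set set" where
  "coord_algebra E I =
     sigma_sets (PiE {1..} (\<lambda>_. space E))
       {{\<omega> \<in> PiE {1..} (\<lambda>_. space E). \<omega> m \<in> S} | m S. m \<in> I \<and> S \<in> sets E}"

text \<open>
  The suprema below are taken over nonempty sets of reals bounded by 1, so they are genuine suprema.
\<close>

definition mixing_coeff :: "'w measure \<Rightarrow> (nat \<Rightarrow> 'w) measure \<Rightarrow> nat \<Rightarrow> real" where
  "mixing_coeff E P n =
     (SUP i\<in>{1..}. SUP (A, B)\<in>coord_algebra E {1..i} \<times> coord_algebra E {i + n..}.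
        \<bar>measure P (A \<inter> B) - measure P A * measure P B\<bar>)"

definition SA2 :: "'w measure \<Rightarrow> (nat \<Rightarrow> 'w) measure \<Rightarrow> (nat \<Rightarrow> real) \<Rightarrow> bool" where
  "SA2 E P \<alpha> \<longleftrightarrow>
     antimono_on {1..} \<alpha> \<and> \<alpha> \<longlonglongrightarrow> 0 \<and> (\<forall>n\<ge>1. mixing_coeff E P n \<le> \<alpha> n)"

definition test_functions ::
    "('w \<Rightarrow> 'x \<Rightarrow> 'x) \<Rightarrow> ('x \<Rightarrow> real) \<Rightarrow> (nat \<Rightarrow> 'w) \<Rightarrow> ('x \<Rightarrow> real) set" where
  "test_functions T f \<omega> =
     range (\<lambda>m. f \<circ> cocycle T m \<omega>) \<union> range (\<lambda>m x. f x * f (cocycle T m \<omega> x))"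

definition SA3 ::
    "(nat \<Rightarrow> 'w) measure \<Rightarrow> ('w \<Rightarrow> 'x \<Rightarrow> 'x) \<Rightarrow> 'x measure \<Rightarrow> ('x \<Rightarrow> real) \<Rightarrow> (nat \<Rightarrow> real) \<Rightarrow> bool" where
  "SA3 P T \<mu> f \<eta> \<longleftrightarrow>
     (\<exists>C\<ge>0. AE \<omega> in P. \<forall>k. \<forall>r\<le>k. \<forall>g\<in>test_functions T f ((shift ^^ k) \<omega>).
        \<bar>(\<integral>x. g (cocycle T k \<omega> x) \<partial>\<mu>) -
         (\<integral>x. g (cocycle T (k - r) ((shift ^^ r) \<omega>) x) \<partial>\<mu>)\<bar> \<le> C * \<eta> (k - r))"

text \<open>The sequence \<open>A n\<^sup>-\<^sup>\<psi>\<close> with the convention \<open>0\<^sup>-\<^sup>\<psi> = 1\<close> (whereas \<open>0 powr a = 0\<close>).\<close>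

definition power_decay :: "real \<Rightarrow> real \<Rightarrow> nat \<Rightarrow> real" where
  "power_decay A \<psi> n = (if n = 0 then A else A * real n powr (- \<psi>))"

end

theory Submission
  imports Defs
begin

text \<open>
  Up to the factor \<open>1 / n\<close>, \<open>\<sigma>\<^sub>n\<^sup>2\<close> is a sum of increments, \<open>n \<sigma>\<^sub>n\<^sup>2 = w\<^sub>0 + \<dots> + w\<^bsub>n-1\<^esub>\<close>, where \<open>w\<^sub>k\<close>
  collects the covariances of time \<open>k\<close> with the times up to \<open>k\<close>.  So the claim is a strong law
  with a rate for the centred increments \<open>X\<^sub>k = w\<^sub>k - E w\<^sub>k\<close>, and it follows from a bound
  \<open>\<bar>E (X\<^sub>k X\<^sub>l)\<bar> = O((1 + \<bar>k - l\<bar>) powr -\<beta>)\<close> with \<open>\<beta> = min (\<psi> - 1) \<gamma>\<close>.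

  This bound is \<open>increment_correlation_decay\<close>.  The increment \<open>w\<^sub>k\<close> depends only on the coordinates
  up to \<open>k\<close>.  For \<open>l > k\<close>, the increment \<open>w\<^sub>l\<close> is close to a function of the coordinates
  after some \<open>r\<close> between \<open>k\<close> and \<open>l\<close>: covariances of time \<open>l\<close> with remote times are small by (SA1),
  and in the others (SA3) allows the dynamics to be restarted at time \<open>r\<close>
  (\<open>increment_decoupling\<close>).  Both errors are tails of \<open>\<eta>\<close>, of order \<open>(l - k) powr (1 - \<psi>)\<close>.  The
  past and the future that remain are almost independent by (SA2), at the rate
  \<open>(l - k) powr -\<gamma>\<close> (\<open>covariance_le_mixing\<close>).

  The correlation bound gives second moments of order \<open>n powr a\<close> for every block of \<open>n\<close> consecutive
  increments, where \<open>a = 1\<close> if \<open>\<beta> > 1\<close> and \<open>a = 2 - \<beta>\<close> if \<open>\<beta> < 1\<close>.  A dyadic chaining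
  argument turns this into the almost sure bound
  \<open>X\<^sub>0 + \<dots> + X\<^bsub>n-1\<^esub> = O(n powr (a / 2) * ln n powr (3 / 2 + \<delta>))\<close> (\<open>gal_koksma\<close>).  The case \<open>\<beta> = 1\<close>
  is reduced to exponents slightly below \<open>1\<close>; this costs an arbitrarily small power of \<open>n\<close>.
\<close>

section \<open>Almost sure growth of partial sums\<close>

text \<open>
  Cutting \<open>{0..<n}\<close> along the binary expansion of \<open>n\<close> uses at most one dyadic block of each length
  \<open>2 ^ j\<close>. The Cauchy--Schwarz inequality then bounds the partial sums for all \<open>n < 2 ^ (N + 1)\<close> at
  once by a sum of squares over the dyadic blocks alone, which is what makes a maximal inequality
  out of a bound for single blocks.
\<close>
lemma dyadic_chaining:
  fixes S :: "nat \<Rightarrow> real"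
  assumes "n < 2 ^ Suc N"
  shows "(S n - S 0)\<^sup>2 \<le> real (Suc N) *
    (\<Sum>j\<le>N. \<Sum>b<2 ^ (Suc N - j). (S (Suc b * 2 ^ j) - S (b * 2 ^ j))\<^sup>2)"
proof -
  \<comment> \<open>\<open>t j\<close> is \<open>n\<close> with its lowest \<open>j\<close> binary digits cleared.\<close>
  define t where "t j = n div 2 ^ j * 2 ^ j" for j :: nat
  have t0: "t 0 = n" and tN: "t (Suc N) = 0"
    using assms by (auto simp: t_def)
  have "S n - S 0 = (\<Sum>j\<le>N. S (t j) - S (t (Suc j)))"
    using sum_telescope[of "\<lambda>j. S (t j)" N] t0 tN by simp
  then have "(S n - S 0)\<^sup>2 \<le> (\<Sum>j\<le>N. 1\<^sup>2) * (\<Sum>j\<le>N. (S (t j) - S (t (Suc j)))\<^sup>2)"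
    using Cauchy_Schwarz_ineq_sum[of "\<lambda>_. 1" "\<lambda>j. S (t j) - S (t (Suc j))" "{..N}"] by simp
  also have "\<dots> = real (Suc N) * (\<Sum>j\<le>N. (S (t j) - S (t (Suc j)))\<^sup>2)"
    by simp
  also have "\<dots> \<le> real (Suc N) *
    (\<Sum>j\<le>N. \<Sum>b<2 ^ (Suc N - j). (S (Suc b * 2 ^ j) - S (b * 2 ^ j))\<^sup>2)"
  proof (intro mult_left_mono sum_mono)
    fix j assume "j \<in> {..N}"
    then have j: "j \<le> N" by simp
    define b where "b = 2 * (n div 2 ^ Suc j)"
    have d: "n div 2 ^ Suc j = n div 2 ^ j div 2"
      by (metis div_mult2_eq power_Suc2)
    have lo: "t (Suc j) = b * 2 ^ j"
      by (simp add: t_def b_def)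
    have cs: "t j = b * 2 ^ j \<or> t j = Suc b * 2 ^ j"
    proof -
      have "n div 2 ^ j = b \<or> n div 2 ^ j = Suc b"
        unfolding b_def d 
        using mult_div_mod_eq[of 2 "n div 2 ^ j"] mod_less_divisor[of 2 "n div 2 ^ j"] by linarith
      then show ?thesis unfolding t_def by metis
    qed
    show "(S (t j) - S (t (Suc j)))\<^sup>2
      \<le> (\<Sum>b<2 ^ (Suc N - j). (S (Suc b * 2 ^ j) - S (b * 2 ^ j))\<^sup>2)"
    proof (cases "t j = b * 2 ^ j")
      case True
      then show ?thesis using lo by (simp add: sum_nonneg)
    next
      case False
      have "b \<le> n div 2 ^ j" unfolding b_def d by simp
      also have "\<dots> < 2 ^ (Suc N - j)"
      proof -
        have "n < 2 ^ (Suc N - j) * 2 ^ j"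
          using assms j by (simp flip: power_add)
        then show ?thesis by (simp add: less_mult_imp_div_less)
      qed
      finally have "b \<in> {..<2 ^ (Suc N - j)}" by simp
      from member_le_sum[OF this, of "\<lambda>b. (S (Suc b * 2 ^ j) - S (b * 2 ^ j))\<^sup>2"]
      show ?thesis using lo cs False by auto
    qed
  qed simp
  finally show ?thesis .
qed

text \<open>
  The sum over \<open>N\<close> of \<open>Q N / t N\<close> has finite expectation, so it is finite almost surely and bounds
  each of its terms.
\<close>
lemma (in prob_space) AE_bounded_ratio:
  fixes Q :: "nat \<Rightarrow> 'a \<Rightarrow> real"
  assumes int: "\<And>N. integrable M (Q N)" and nonneg: "\<And>N \<omega>. 0 \<le> Q N \<omega>"
    and bound: "\<And>N. expectation (Q N) \<le> q N" and t: "\<And>N. 0 < t N"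
    and sm: "summable (\<lambda>N. q N / t N)"
  shows "AE \<omega> in M. \<exists>B. \<forall>N. Q N \<omega> \<le> B * t N"
proof -
  have [measurable]: "Q N \<in> borel_measurable M" for N
    using int by (rule borel_measurable_integrable)
  have q: "0 \<le> q N" for N
    
    using bound[of N] Bochner_Integration.integral_nonneg[of M "Q N"] nonneg by (meson order_trans)
  have "(\<integral>\<^sup>+\<omega>. (\<Sum>N. ennreal (Q N \<omega> / t N)) \<partial>M) = (\<Sum>N. \<integral>\<^sup>+\<omega>. ennreal (Q N \<omega> / t N) \<partial>M)"
    by (rule nn_integral_suminf) measurable
  also have "\<dots> = (\<Sum>N. ennreal (expectation (Q N) / t N))"
    using int nonneg t
    by (subst nn_integral_eq_integral) (auto simp: less_imp_le)
  also have "\<dots> \<le> (\<Sum>N. ennreal (q N / t N))"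
    using bound t by (intro suminf_le ennreal_leI divide_right_mono) (auto simp: less_imp_le)
  also have "\<dots> = ennreal (\<Sum>N. q N / t N)"
    using sm q t by (intro suminf_ennreal2) (auto simp: less_imp_le)
  finally have "(\<integral>\<^sup>+\<omega>. (\<Sum>N. ennreal (Q N \<omega> / t N)) \<partial>M) \<noteq> \<infinity>"
    by (auto simp: top_unique)
  then have "AE \<omega> in M. (\<Sum>N. ennreal (Q N \<omega> / t N)) \<noteq> \<infinity>"
    by (intro nn_integral_PInf_AE) auto
  then show ?thesis
  proof eventually_elim
    case (elim \<omega>)
    then obtain B where B: "0 \<le> B" "(\<Sum>N. ennreal (Q N \<omega> / t N)) = ennreal B"
      by (cases "\<Sum>N. ennreal (Q N \<omega> / t N)") auto
    have "Q N \<omega> \<le> B * t N" for N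
    proof -
      have "ennreal (Q N \<omega> / t N) \<le> (\<Sum>N. ennreal (Q N \<omega> / t N))"
        using sum_le_suminf[of "\<lambda>N. ennreal (Q N \<omega> / t N)" "{N}"] by simp
      then have "Q N \<omega> / t N \<le> B" using B by simp
      then show ?thesis using t[of N] by (simp add: pos_divide_le_eq)
    qed
    then show ?case by blast
  qed
qed

text \<open>
  A strong law of Gal--Koksma type.  With \<open>Q N\<close> the sum of squares from \<open>dyadic_chaining\<close>, the hypothesis
  gives \<open>E (Q N) \<le> 2 C (N + 1) 2 ^ (a N)\<close>: there are \<open>2 ^ (N + 1 - j)\<close> blocks of length \<open>2 ^ j\<close>, and
  because \<open>a \<ge> 1\<close> each of the \<open>N + 1\<close> scales contributes at most as much as the top one.  Dividing
  by \<open>(N + 1) ^ (2 + 2 \<delta>) 2 ^ (a N)\<close> makes these expectations summable, and one more factor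
  \<open>N + 1\<close> from the chaining gives the exponent \<open>3 + 2 \<delta>\<close> of the logarithm in the squared bound.
\<close>
theorem (in prob_space) gal_koksma:
  fixes X :: "nat \<Rightarrow> 'a \<Rightarrow> real"
  assumes int: "\<And>m n. integrable M (\<lambda>\<omega>. (\<Sum>k=m..<m+n. X k \<omega>)\<^sup>2)"
    and second_moment: "\<And>m n. expectation (\<lambda>\<omega>. (\<Sum>k=m..<m+n. X k \<omega>)\<^sup>2) \<le> C * real n powr a"
    and "a \<ge> 1" "\<delta> > 0"
  shows "AE \<omega> in M. (\<lambda>n. \<Sum>k<n. X k \<omega>) \<in> O(\<lambda>n. real n powr (a / 2) * ln (real n) powr (3 / 2 + \<delta>))"
proof -
  define S where "S \<omega> n = (\<Sum>k<n. X k \<omega>)" for \<omega> n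
  define Q where "Q N \<omega> = (\<Sum>j\<le>N. \<Sum>b<2 ^ (Suc N - j). (S \<omega> (Suc b * 2 ^ j) - S \<omega> (b * 2 ^ j))\<^sup>2)"
    for N \<omega>
  define t where "t N = real (Suc N) powr (2 + 2 * \<delta>) * (2 ^ N) powr a" for N
  have S_diff: "S \<omega> (Suc b * 2 ^ j) - S \<omega> (b * 2 ^ j) = (\<Sum>k = b * 2 ^ j..<b * 2 ^ j + 2 ^ j. X k \<omega>)"
    for \<omega> b j
  proof -
    have "S \<omega> (b * 2 ^ j + 2 ^ j) = S \<omega> (b * 2 ^ j) + (\<Sum>k = b * 2 ^ j..<b * 2 ^ j + 2 ^ j. X k \<omega>)"
      unfolding S_def lessThan_atLeast0 by (rule sum.atLeastLessThan_concat[symmetric]) auto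
    then show ?thesis by (simp add: add.commute)
  qed
  have "0 \<le> expectation (\<lambda>\<omega>. (\<Sum>k=0..<0+1. X k \<omega>)\<^sup>2)" by (rule Bochner_Integration.integral_nonneg) simp
  then have C: "0 \<le> C" using order_trans[OF _ second_moment[of 0 1]] by simp
  have "AE \<omega> in M. \<exists>B. \<forall>N. Q N \<omega> \<le> B * t N"
  proof (rule AE_bounded_ratio)
    show "integrable M (Q N)" for N
      unfolding Q_def S_diff by (intro Bochner_Integration.integrable_sum int)
    show "0 \<le> Q N \<omega>" for N \<omega>
      unfolding Q_def by (intro sum_nonneg) auto
    show "0 < t N" for N by (simp add: t_def)
    show "expectation (Q N) \<le> 2 * C * real (Suc N) * (2 ^ N) powr a" for N
    proof -
      have "expectation (Q N) = (\<Sum>j\<le>N. \<Sum>b<2 ^ (Suc N - j).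
          expectation (\<lambda>\<omega>. (\<Sum>k = b * 2 ^ j..<b * 2 ^ j + 2 ^ j. X k \<omega>)\<^sup>2))"
        unfolding Q_def S_diff
        by (subst Bochner_Integration.integral_sum)
          (auto intro!: Bochner_Integration.integrable_sum int sum.cong Bochner_Integration.integral_sum)
      also have "\<dots> \<le> (\<Sum>j\<le>N. \<Sum>b<(2::nat) ^ (Suc N - j). C * real (2 ^ j) powr a)"
        by (intro sum_mono second_moment)
      also have "\<dots> \<le> (\<Sum>j\<le>N. 2 * C * (2 ^ N) powr a)"
      proof (rule sum_mono)
        fix j assume "j \<in> {..N}"
        then have j: "j \<le> N" by simp
        have "(2 :: real) ^ (N - j) * (2 ^ j) powr a \<le> (2 ^ N) powr a"
        proof -
          have "(2 :: real) ^ (N - j) * (2 ^ j) powr a = 2 powr (real (N - j) + real j * a)"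
            by (simp add: powr_add powr_powr flip: powr_realpow)
          also have "\<dots> \<le> 2 powr (real N * a)"
          proof -
            have "real (N - j) * 1 \<le> real (N - j) * a"
              using \<open>a \<ge> 1\<close> by (intro mult_left_mono) auto
            then have "real (N - j) + real j * a \<le> real N * a"
              using j by (simp add: of_nat_diff algebra_simps)
            then show ?thesis by simp
          qed
          also have "\<dots> = (2 ^ N) powr a"
            by (simp add: powr_powr flip: powr_realpow)
          finally show ?thesis .
        qed
        from mult_left_mono[OF this, of "2 * C"] C
        show "(\<Sum>b<(2::nat) ^ (Suc N - j). C * real (2 ^ j) powr a) \<le> 2 * C * (2 ^ N) powr a"
          using j by (simp add: Suc_diff_le mult_ac)
      qed
      finally show ?thesis by (simp add: algebra_simps)
    qed
    have "summable (\<lambda>N. 2 * C * real (Suc N) powr (- (1 + 2 * \<delta>)))"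
      using \<open>\<delta> > 0\<close> by (intro summable_mult summable_Suc_iff[THEN iffD2]) (simp add: summable_real_powr_iff)
    also have "(\<lambda>N. 2 * C * real (Suc N) powr (- (1 + 2 * \<delta>)))
      = (\<lambda>N. 2 * C * real (Suc N) * (2 ^ N) powr a / t N)"
    proof
      fix N
      have "real (Suc N) powr (2 + 2 * \<delta>) = real (Suc N) * real (Suc N) powr (1 + 2 * \<delta>)"
        using powr_add[of "real (Suc N)" 1 "1 + 2 * \<delta>"] by simp
      then show "2 * C * real (Suc N) powr (- (1 + 2 * \<delta>)) = 2 * C * real (Suc N) * (2 ^ N) powr a / t N"
        unfolding t_def powr_minus[of "real (Suc N)" "1 + 2 * \<delta>"] by (simp add: field_simps del: of_nat_Suc)
    qed
    finally show "summable (\<lambda>N. 2 * C * real (Suc N) * (2 ^ N) powr a / t N)" .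
  qed
  then show ?thesis
  proof eventually_elim
    case (elim \<omega>)
    then obtain B where B: "\<And>N. Q N \<omega> \<le> B * t N" by blast
    have "0 \<le> Q 0 \<omega>" unfolding Q_def by (intro sum_nonneg) auto
    with B[of 0] have B0: "0 \<le> B" by (simp add: t_def)
    define c where "c = (2 / ln 2 :: real) powr (3 + 2 * \<delta>)"
    have "norm (S \<omega> n) \<le> sqrt (B * c) * norm (real n powr (a / 2) * ln (real n) powr (3 / 2 + \<delta>))"
      if n: "n \<ge> 2" for n
    proof -
      obtain N where N: "2 ^ N \<le> n" "n < 2 ^ Suc N"
        using ex_power_ivl1[of 2 n] n by auto
      have N1: "N \<ge> 1" using N n by (cases N) auto
      have "(S \<omega> n)\<^sup>2 \<le> real (Suc N) * Q N \<omega>"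
        using dyadic_chaining[OF N(2), of "S \<omega>"] by (simp add: Q_def S_def)
      also have "\<dots> \<le> real (Suc N) * (B * t N)"
        by (intro mult_left_mono B) simp
      also have "\<dots> = B * (real (Suc N) powr (3 + 2 * \<delta>) * (2 ^ N) powr a)"
        using powr_add[of "real (Suc N)" 1 "2 + 2 * \<delta>"]
        by (simp add: t_def)
      also have "\<dots> \<le> B * ((2 / ln 2 * ln (real n)) powr (3 + 2 * \<delta>) * real n powr a)"
      proof (intro mult_left_mono mult_mono powr_mono2)
        have "ln (2 ^ N) \<le> ln (real n)"
          using N(1) n by (subst ln_le_cancel_iff) (auto simp flip: of_nat_power)
        then have "real N * ln 2 \<le> ln (real n)" by (simp add: ln_realpow)
        then have "real N \<le> ln (real n) / ln 2" by (simp add: field_simps)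
        moreover have "real (Suc N) \<le> 2 * real N" using N1 by simp
        ultimately show "real (Suc N) \<le> 2 / ln 2 * ln (real n)" by simp
        have "real (2 ^ N) \<le> real n" using N(1) by (simp only: of_nat_le_iff)
        then show "2 ^ N \<le> real n" by simp
      qed (use B0 \<open>\<delta> > 0\<close> \<open>a \<ge> 1\<close> in auto)
      also have "\<dots> = B * c * (real n powr (a / 2) * ln (real n) powr (3 / 2 + \<delta>))\<^sup>2"
      proof -
        have "(real n powr (a / 2))\<^sup>2 = real n powr a"
          "(ln (real n) powr (3 / 2 + \<delta>))\<^sup>2 = ln (real n) powr (3 + 2 * \<delta>)"
          by (simp_all add: power2_eq_square flip: powr_add)
        then show ?thesis using n by (simp add: power_mult_distrib powr_mult c_def powr_divide mult_ac)
      qed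
      finally have "sqrt ((S \<omega> n)\<^sup>2) \<le>
          sqrt (B * c * (real n powr (a / 2) * ln (real n) powr (3 / 2 + \<delta>))\<^sup>2)"
        by (rule real_sqrt_le_mono)
      then show ?thesis
        by (simp add: real_sqrt_mult abs_mult)
    qed
    then show ?case
      unfolding S_def by (intro bigoI[where c = "sqrt (B * c)"] eventually_sequentiallyI[of 2]) auto
  qed
qed

lemma (in prob_space) second_moment_of_correlation_decay:
  fixes X :: "nat \<Rightarrow> 'a \<Rightarrow> real"
  assumes meas: "\<And>k. X k \<in> borel_measurable M"
    and bdd: "\<And>k. AE \<omega> in M. \<bar>X k \<omega>\<bar> \<le> B"
    and corr: "\<And>k l. k \<le> l \<Longrightarrow> \<bar>expectation (\<lambda>\<omega>. X k \<omega> * X l \<omega>)\<bar> \<le> \<rho> (l - k)"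
  shows "integrable M (\<lambda>\<omega>. (\<Sum>k=m..<m+n. X k \<omega>)\<^sup>2)"
    and "expectation (\<lambda>\<omega>. (\<Sum>k=m..<m+n. X k \<omega>)\<^sup>2) \<le> 2 * real n * (\<Sum>d<n. \<rho> d)"
proof -
  note meas[measurable]
  have int: "integrable M (\<lambda>\<omega>. X k \<omega> * X l \<omega>)" for k l
  proof (rule integrable_const_bound)
    show "AE \<omega> in M. norm (X k \<omega> * X l \<omega>) \<le> B * B"
      using bdd[of k] bdd[of l]
      by eventually_elim (simp add: abs_mult, intro mult_mono, auto)
  qed measurable
  have sq: "(\<Sum>k=m..<m+n. X k \<omega>)\<^sup>2 = (\<Sum>k=m..<m+n. \<Sum>l=m..<m+n. X k \<omega> * X l \<omega>)" for \<omega>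
    by (simp add: power2_eq_square sum_product)
  show "integrable M (\<lambda>\<omega>. (\<Sum>k=m..<m+n. X k \<omega>)\<^sup>2)"
    unfolding sq by (intro Bochner_Integration.integrable_sum int)
  have \<rho>: "0 \<le> \<rho> d" for d
    using corr[of 0 d] by simp
  have corr': "expectation (\<lambda>\<omega>. X k \<omega> * X l \<omega>) \<le> (if k \<le> l then \<rho> (l - k) else \<rho> (k - l))" for k l
    using corr[of k l] corr[of l k] by (auto simp: mult.commute abs_le_iff)
  have "expectation (\<lambda>\<omega>. (\<Sum>k=m..<m+n. X k \<omega>)\<^sup>2)
    = (\<Sum>k=m..<m+n. \<Sum>l=m..<m+n. expectation (\<lambda>\<omega>. X k \<omega> * X l \<omega>))"
    unfolding sq using int by (simp add: Bochner_Integration.integral_sum)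
  also have "\<dots> \<le> (\<Sum>k=m..<m+n. 2 * (\<Sum>d<n. \<rho> d))"
  proof (rule sum_mono)
    fix k assume k: "k \<in> {m..<m+n}"
    have "(\<Sum>l=m..<m+n. expectation (\<lambda>\<omega>. X k \<omega> * X l \<omega>))
      \<le> (\<Sum>l=m..<m+n. (if l \<in> {k..} then \<rho> (l - k) else 0) + (if l \<in> {..k} then \<rho> (k - l) else 0))"
    proof (rule sum_mono)
      fix l
      show "expectation (\<lambda>\<omega>. X k \<omega> * X l \<omega>)
        \<le> (if l \<in> {k..} then \<rho> (l - k) else 0) + (if l \<in> {..k} then \<rho> (k - l) else 0)"
        using corr'[of k l] \<rho>[of "l - k"] \<rho>[of "k - l"] by (auto split: if_splits)
    qed
    also have "\<dots> = (\<Sum>l\<in>{m..<m+n} \<inter> {k..}. \<rho> (l - k)) + (\<Sum>l\<in>{m..<m+n} \<inter> {..k}. \<rho> (k - l))"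
      by (simp only: sum.distrib sum.inter_restrict finite_atLeastLessThan)
    also have "(\<Sum>l\<in>{m..<m+n} \<inter> {k..}. \<rho> (l - k)) = sum \<rho> ((\<lambda>l. l - k) ` ({m..<m+n} \<inter> {k..}))"
      by (subst sum.reindex) (auto simp: inj_on_def)
    also have "\<dots> \<le> (\<Sum>d<n. \<rho> d)"
      using k \<rho> by (intro sum_mono2) auto
    also have "(\<Sum>l\<in>{m..<m+n} \<inter> {..k}. \<rho> (k - l)) = sum \<rho> ((\<lambda>l. k - l) ` ({m..<m+n} \<inter> {..k}))"
      by (subst sum.reindex) (auto simp: inj_on_def)
    also have "\<dots> \<le> (\<Sum>d<n. \<rho> d)"
      using k \<rho> by (intro sum_mono2) auto
    finally show "(\<Sum>l=m..<m+n. expectation (\<lambda>\<omega>. X k \<omega> * X l \<omega>)) \<le> 2 * (\<Sum>d<n. \<rho> d)"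
      by simp
  qed
  finally show "expectation (\<lambda>\<omega>. (\<Sum>k=m..<m+n. X k \<omega>)\<^sup>2) \<le> 2 * real n * (\<Sum>d<n. \<rho> d)"
    by simp
qed

lemma (in prob_space) abs_expectation_le:
  fixes g :: "'a \<Rightarrow> real"
  assumes "integrable M g" "AE \<omega> in M. \<bar>g \<omega>\<bar> \<le> B"
  shows "\<bar>expectation g\<bar> \<le> B"
proof -
  have "expectation g \<le> B"
    by (rule integral_le_const) (use assms in \<open>auto elim!: AE_mp\<close>)
  moreover have "- B \<le> expectation g"
    by (rule integral_ge_const) (use assms in \<open>auto elim!: AE_mp\<close>)
  ultimately show ?thesis by linarith
qed

section \<open>Sums of power-law sequences\<close>

text \<open>
  Comparison of a power with the increments of the next higher power, so that sums of powers can be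
  bounded by telescoping; \<open>q < 0\<close> serves for tails and \<open>0 < q < 1\<close> for partial sums.
\<close>
lemma powr_increment_lower_bound:
  fixes q y :: real
  assumes "y > 0" "q \<le> 1"
  shows "\<bar>q\<bar> * (y + 1) powr (q - 1) \<le> \<bar>(y + 1) powr q - y powr q\<bar>"
proof -
  have "\<exists>z. y < z \<and> z < y + 1 \<and> (y + 1) powr q - y powr q = (y + 1 - y) * (q * z powr (q - 1))"
  proof (rule MVT2)
    fix x assume "y \<le> x" "x \<le> y + 1"
    then show "((\<lambda>x. x powr q) has_real_derivative q * x powr (q - 1)) (at x)"
      using assms by (intro has_real_derivative_powr) auto
  qed simp
  then obtain z where z: "y < z" "z < y + 1" "(y + 1) powr q - y powr q = q * z powr (q - 1)"
    by auto
  have "(y + 1) powr (q - 1) \<le> z powr (q - 1)"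
    using z assms by (intro powr_mono2') auto
  then show ?thesis using z(3) by (simp add: abs_mult mult_left_mono)
qed

text \<open>
  The exponent \<open>\<beta> = 1\<close> is excluded because the partial sums then grow logarithmically, which is not
  of the form \<open>n ^ (1 - min 1 \<beta>)\<close>.
\<close>
lemma sum_powr_decay_le:
  fixes \<beta> :: real
  assumes "\<beta> > 0" "\<beta> \<noteq> 1"
  shows "\<exists>c\<ge>0. \<forall>n. (\<Sum>d<n. real (Suc d) powr (- \<beta>)) \<le> c * real n powr (1 - min 1 \<beta>)"
proof (cases "\<beta> > 1")
  case True
  have sm: "summable (\<lambda>d. real (Suc d) powr (- \<beta>))"
    using True by (intro summable_Suc_iff[THEN iffD2]) (simp add: summable_real_powr_iff)
  let ?c = "\<Sum>d. real (Suc d) powr (- \<beta>)"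
  have "(\<Sum>d<n. real (Suc d) powr (- \<beta>)) \<le> ?c * real n powr (1 - min 1 \<beta>)" for n
  proof (cases "n = 0")
    case False
    then show ?thesis using True sum_le_suminf[OF sm, of "{..<n}"] by simp
  qed simp
  moreover have "?c \<ge> 0" using sm by (intro suminf_nonneg) auto
  ultimately show ?thesis by blast
next
  case False
  with assms have b: "\<beta> < 1" by simp
  have "(\<Sum>d<n. real (Suc d) powr (- \<beta>)) \<le> 1 / (1 - \<beta>) * real n powr (1 - \<beta>)" for n
  proof (induction n)
    case (Suc n)
    have step: "(1 - \<beta>) * real (Suc n) powr (- \<beta>) \<le> real (Suc n) powr (1 - \<beta>) - real n powr (1 - \<beta>)"
    proof (cases "n = 0")
      case False
      have "real n powr (1 - \<beta>) \<le> real (Suc n) powr (1 - \<beta>)" using b by (intro powr_mono2) auto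
      then show ?thesis
        using powr_increment_lower_bound[of "real n" "1 - \<beta>"] assms b False by (simp add: add.commute)
    qed (use assms in simp)
    have "real (Suc n) powr (- \<beta>) \<le> (real (Suc n) powr (1 - \<beta>) - real n powr (1 - \<beta>)) / (1 - \<beta>)"
      using step b by (simp add: pos_le_divide_eq mult.commute)
    with Suc show ?case by (simp add: diff_divide_distrib)
  qed simp
  then show ?thesis using b by (intro exI[of _ "1 / (1 - \<beta>)"]) (auto simp: min_def)
qed

lemma sum_le_tail:
  fixes \<eta> :: "nat \<Rightarrow> real"
  assumes "finite I" "inj_on g I" "\<And>i. i \<in> I \<Longrightarrow> p \<le> g i" "\<And>n. 0 \<le> \<eta> n" "summable \<eta>"
  shows "(\<Sum>i\<in>I. \<eta> (g i)) \<le> (\<Sum>d. \<eta> (d + p))"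
proof -
  have inj: "inj_on (\<lambda>i. g i - p) I"
    using assms(2,3) by (auto simp: inj_on_def eq_diff_iff)
  have "(\<Sum>i\<in>I. \<eta> (g i)) = (\<Sum>i\<in>I. \<eta> (g i - p + p))"
    using assms(3) by (intro sum.cong) auto
  also have "\<dots> = (\<Sum>d\<in>(\<lambda>i. g i - p) ` I. \<eta> (d + p))"
    using sum.reindex[OF inj, of "\<lambda>d. \<eta> (d + p)"] by simp
  also have "\<dots> \<le> (\<Sum>d. \<eta> (d + p))"
    using assms by (intro sum_le_suminf summable_ignore_initial_segment) auto
  finally show ?thesis .
qed

lemma power_decay_tail:
  assumes "\<psi> > 1" "A \<ge> 0"
  shows "\<exists>c\<ge>0. \<forall>p. (\<Sum>d. power_decay A \<psi> (d + p)) \<le> c * real (Suc p) powr (1 - \<psi>)"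
proof -
  define c where "c = A * 3 powr \<psi> / (\<psi> - 1)"
  define h where "h p d = real (Suc (d + p)) powr (1 - \<psi>)" for p d
  have c: "c \<ge> 0" using assms by (simp add: c_def)
  have le: "power_decay A \<psi> (d + p) \<le> c * (h p d - h p (Suc d))" for d p
  proof -
    let ?y = "real (Suc (d + p))"
    have "?y powr (1 - \<psi>) \<ge> (?y + 1) powr (1 - \<psi>)"
      using assms by (intro powr_mono2') auto
    then have 1: "(\<psi> - 1) * (?y + 1) powr (- \<psi>) \<le> h p d - h p (Suc d)"
      using powr_increment_lower_bound[of ?y "1 - \<psi>"] assms by (simp add: h_def add_ac)
    have 2: "power_decay A \<psi> (d + p) \<le> A * (3 powr \<psi> * (?y + 1) powr (- \<psi>))"
    proof (cases "d + p = 0")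
      case True
      have "(3::real) powr \<psi> * 2 powr (- \<psi>) \<ge> 1"
        using assms by (simp add: powr_minus divide_simps powr_mono2)
      then show ?thesis using True assms mult_left_mono[of 1 _ A] by (simp add: power_decay_def)
    next
      case False
      \<comment> \<open>\<open>x + 2 \<le> 3 x\<close> for \<open>x = d + p \<ge> 1\<close>.\<close>
      have "real (d + p) powr (- \<psi>) \<le> ((?y + 1) / 3) powr (- \<psi>)"
        using False assms by (intro powr_mono2') auto
      also have "\<dots> = 3 powr \<psi> * (?y + 1) powr (- \<psi>)"
        using powr_divide[of "?y + 1" 3 "- \<psi>"] by (simp add: powr_minus divide_simps)
      finally have "A * real (d + p) powr (- \<psi>) \<le> A * (3 powr \<psi> * (?y + 1) powr (- \<psi>))"
        using assms by (intro mult_left_mono) auto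
      then show ?thesis using False by (simp only: power_decay_def if_False)
    qed
    have "A * (3 powr \<psi> * (?y + 1) powr (- \<psi>)) = c * ((\<psi> - 1) * (?y + 1) powr (- \<psi>))"
      using assms by (simp add: c_def)
    also have "\<dots> \<le> c * (h p d - h p (Suc d))"
      by (intro mult_left_mono 1 c)
    finally show ?thesis using 2 by linarith
  qed
  have "(\<Sum>d. power_decay A \<psi> (d + p)) \<le> c * real (Suc p) powr (1 - \<psi>)" for p
  proof -
    have "h p \<longlonglongrightarrow> 0"
    proof -
      have "(\<lambda>n. real n powr (1 - \<psi>)) \<longlonglongrightarrow> 0"
        using assms by (intro tendsto_neg_powr filterlim_real_sequentially) auto
      from LIMSEQ_ignore_initial_segment[OF this, of "Suc p"] show ?thesis by (simp add: h_def[abs_def] add_ac)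
    qed
    from telescope_sums'[OF this] have s: "(\<lambda>d. c * (h p d - h p (Suc d))) sums (c * (h p 0 - 0))"
      by (rule sums_mult)
    have "summable (\<lambda>d. power_decay A \<psi> (d + p))"
      using le assms by (intro summable_comparison_test'[OF sums_summable[OF s]])
        (auto simp: power_decay_def)
    then have "(\<Sum>d. power_decay A \<psi> (d + p)) \<le> c * (h p 0 - 0)"
      using suminf_le[OF le _ sums_summable[OF s]] sums_unique[OF s] by simp
    then show ?thesis by (simp add: h_def)
  qed
  with c show ?thesis by blast
qed

section \<open>Covariances under strong mixing\<close>

text \<open>
  Mixing controls events, hence indicator functions.  The level sets \<open>{U \<ge> k / n}\<close> express the
  discretisation \<open>\<lfloor>n U\<rfloor> / n\<close> as an average of \<open>n\<close> indicators, so the covariance of two discretised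
  functions is an average of \<open>n\<^sup>2\<close> covariances of events and does not exceed \<open>\<alpha>\<close>.  The
  discretisation error is at most \<open>4 / n\<close> and disappears in the limit.
\<close>
lemma (in prob_space) covariance_le_mixing_unit:
  fixes U V :: "'a \<Rightarrow> real"
  assumes F: "subalgebra M F" and G: "subalgebra M G"
    and U: "U \<in> borel_measurable F" and V: "V \<in> borel_measurable G"
    and U01: "\<And>\<omega>. 0 \<le> U \<omega> \<and> U \<omega> \<le> 1" and V01: "\<And>\<omega>. 0 \<le> V \<omega> \<and> V \<omega> \<le> 1"
    and mix: "\<And>A B. A \<in> sets F \<Longrightarrow> B \<in> sets G \<Longrightarrow> \<bar>prob (A \<inter> B) - prob A * prob B\<bar> \<le> \<alpha>"
  shows "\<bar>expectation (\<lambda>\<omega>. U \<omega> * V \<omega>) - expectation U * expectation V\<bar> \<le> \<alpha>"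
proof -
  have UM[measurable]: "U \<in> borel_measurable M" and VM[measurable]: "V \<in> borel_measurable M"
    using measurable_from_subalg F G U V by blast+
  have spF: "space F = space M" and spG: "space G = space M"
    using F G by (auto simp: subalgebra_def)
  define A where "A n k = {\<omega> \<in> space M. real k \<le> real n * U \<omega>}" for n k :: nat
  define B where "B n k = {\<omega> \<in> space M. real k \<le> real n * V \<omega>}" for n k :: nat
  have A: "A n k \<in> sets F" for n k
    using U unfolding A_def spF[symmetric] by measurable
  have B: "B n k \<in> sets G" for n k
    using V unfolding B_def spG[symmetric] by measurable
  have AM[measurable]: "A n k \<in> events" and BM[measurable]: "B n k \<in> events" for n k
    using A B F G by (auto simp: subalgebra_def)
  \<comment> \<open>For \<open>0 \<le> u \<le> 1\<close> this is \<open>\<lfloor>n u\<rfloor> / n\<close>.\<close>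
  define step where "step n u = (\<Sum>k=1..n. if real k \<le> real n * u then 1 else 0 :: real) / real n"
    for n :: nat and u :: real
  have step: "0 \<le> step n u" "step n u \<le> u" "u - 1 / real n \<le> step n u"
    if "n > 0" "0 \<le> u" "u \<le> 1" for n u
  proof -
    define m where "m = nat \<lfloor>real n * u\<rfloor>"
    have m: "real m \<le> real n * u" "real n * u < real m + 1"
      using that by (auto simp: m_def)
    have "m \<le> n"
    proof -
      have "real n * u \<le> real n" using that by (simp add: mult_left_le)
      then show ?thesis using m(1) by linarith
    qed
    moreover have "real k \<le> real n * u \<longleftrightarrow> k \<le> m" for k
      using m by linarith
    ultimately have "(\<Sum>k=1..n. if real k \<le> real n * u then 1 else 0 :: real) = (\<Sum>k=1..m. 1)"
      by (intro sum.mono_neutral_cong_right) auto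
    then have "step n u = real m / real n" by (simp add: step_def)
    then show "0 \<le> step n u" "step n u \<le> u" "u - 1 / real n \<le> step n u"
      using m that by (simp_all add: pos_divide_le_eq pos_le_divide_eq diff_le_eq mult.commute
        flip: add_divide_distrib)
  qed
  have stepU: "step n (U \<omega>) = (\<Sum>k=1..n. indicator (A n k) \<omega>) / real n" if "\<omega> \<in> space M" for n \<omega>
    unfolding step_def using that
    by (intro arg_cong2[where f = "(/)"] sum.cong) (auto simp: A_def)
  have stepV: "step n (V \<omega>) = (\<Sum>k=1..n. indicator (B n k) \<omega>) / real n" if "\<omega> \<in> space M" for n \<omega>
    unfolding step_def using that
    by (intro arg_cong2[where f = "(/)"] sum.cong) (auto simp: B_def)
  have main: "\<bar>expectation (\<lambda>\<omega>. U \<omega> * V \<omega>) - expectation U * expectation V\<bar> \<le> \<alpha> + 4 / real n"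
    if n: "n > 0" for n
  proof -
    let ?u = "\<lambda>\<omega>. step n (U \<omega>)" and ?v = "\<lambda>\<omega>. step n (V \<omega>)"
    have [measurable]: "?u \<in> borel_measurable M" "?v \<in> borel_measurable M"
      unfolding step_def by measurable
    have u: "0 \<le> ?u \<omega>" "?u \<omega> \<le> U \<omega>" "U \<omega> - 1 / real n \<le> ?u \<omega>" for \<omega>
      using step[OF n, of "U \<omega>"] U01[of \<omega>] by auto
    have v: "0 \<le> ?v \<omega>" "?v \<omega> \<le> V \<omega>" "V \<omega> - 1 / real n \<le> ?v \<omega>" for \<omega>
      using step[OF n, of "V \<omega>"] V01[of \<omega>] by auto
    have bnd: "integrable M h" if "h \<in> borel_measurable M" "\<And>\<omega>. \<bar>h \<omega>\<bar> \<le> 1" for h :: "'a \<Rightarrow> real"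
      using that by (intro integrable_const_bound[of _ 1]) auto
    have u1: "?u \<omega> \<le> 1" and v1: "?v \<omega> \<le> 1" for \<omega>
      using u v U01 V01 order_trans by blast+
    have iU: "integrable M U" and iV: "integrable M V" and iu: "integrable M ?u" and iv: "integrable M ?v"
      and iUV: "integrable M (\<lambda>\<omega>. U \<omega> * V \<omega>)" and iuv: "integrable M (\<lambda>\<omega>. ?u \<omega> * ?v \<omega>)"
      using U01 V01 u v u1 v1 by (auto intro!: bnd simp: abs_mult mult_le_one)
    have "expectation (\<lambda>\<omega>. ?u \<omega> * ?v \<omega>)
      = expectation (\<lambda>\<omega>. (\<Sum>k=1..n. \<Sum>l=1..n. indicator (A n k \<inter> B n l) \<omega>) / (real n)\<^sup>2)"
      by (intro Bochner_Integration.integral_cong refl)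
        (simp add: stepU stepV sum_product power2_eq_square indicator_inter_arith)
    also have "\<dots> = (\<Sum>k=1..n. \<Sum>l=1..n. prob (A n k \<inter> B n l)) / (real n)\<^sup>2"
      by (simp add: Bochner_Integration.integral_sum emeasure_eq_measure)
    finally have Euv: "expectation (\<lambda>\<omega>. ?u \<omega> * ?v \<omega>) = \<dots>" .
    have Eu: "expectation ?u = (\<Sum>k=1..n. prob (A n k)) / real n"
    proof -
      have "expectation ?u = expectation (\<lambda>\<omega>. (\<Sum>k=1..n. indicator (A n k) \<omega>) / real n)"
        by (intro Bochner_Integration.integral_cong refl stepU)
      then show ?thesis by (simp add: Bochner_Integration.integral_sum emeasure_eq_measure)
    qed
    have Ev: "expectation ?v = (\<Sum>k=1..n. prob (B n k)) / real n"
    proof -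
      have "expectation ?v = expectation (\<lambda>\<omega>. (\<Sum>k=1..n. indicator (B n k) \<omega>) / real n)"
        by (intro Bochner_Integration.integral_cong refl stepV)
      then show ?thesis by (simp add: Bochner_Integration.integral_sum emeasure_eq_measure)
    qed
    have "\<bar>expectation (\<lambda>\<omega>. ?u \<omega> * ?v \<omega>) - expectation ?u * expectation ?v\<bar>
      = \<bar>\<Sum>k=1..n. \<Sum>l=1..n. prob (A n k \<inter> B n l) - prob (A n k) * prob (B n l)\<bar> / (real n)\<^sup>2"
      unfolding Euv Eu Ev
      by (simp add: sum_product sum_subtractf power2_eq_square flip: diff_divide_distrib)
    also have "\<dots> \<le> (\<Sum>k=1..n. \<Sum>l=1..n. \<alpha>) / (real n)\<^sup>2"
      by (intro divide_right_mono order_trans[OF sum_abs] sum_mono mix A B) auto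
    also have "\<dots> = \<alpha>" using n by (simp add: power2_eq_square)
    finally have step_cov: "\<bar>expectation (\<lambda>\<omega>. ?u \<omega> * ?v \<omega>) - expectation ?u * expectation ?v\<bar> \<le> \<alpha>" .
    have d1: "\<bar>expectation (\<lambda>\<omega>. U \<omega> * V \<omega>) - expectation (\<lambda>\<omega>. ?u \<omega> * ?v \<omega>)\<bar> \<le> 2 / real n"
    proof -
      have "\<bar>U \<omega> * V \<omega> - ?u \<omega> * ?v \<omega>\<bar> \<le> 2 / real n" for \<omega>
      proof -
        have "U \<omega> * V \<omega> - ?u \<omega> * ?v \<omega> = U \<omega> * (V \<omega> - ?v \<omega>) + (U \<omega> - ?u \<omega>) * ?v \<omega>"
          by (simp add: algebra_simps)
        moreover have "U \<omega> * (V \<omega> - ?v \<omega>) \<le> 1 * (1 / real n)"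
          using u[of \<omega>] v[of \<omega>] U01[of \<omega>] by (intro mult_mono) auto
        moreover have "(U \<omega> - ?u \<omega>) * ?v \<omega> \<le> (1 / real n) * 1"
          using u[of \<omega>] v[of \<omega>] v1[of \<omega>] by (intro mult_mono) auto
        moreover have "0 \<le> U \<omega> * (V \<omega> - ?v \<omega>)" "0 \<le> (U \<omega> - ?u \<omega>) * ?v \<omega>"
          using u[of \<omega>] v[of \<omega>] U01[of \<omega>] by (auto intro!: mult_nonneg_nonneg)
        ultimately show ?thesis by linarith
      qed
      then have "\<bar>expectation (\<lambda>\<omega>. U \<omega> * V \<omega> - ?u \<omega> * ?v \<omega>)\<bar> \<le> 2 / real n"
        using iUV iuv by (intro abs_expectation_le) auto
      then show ?thesis using iUV iuv by simp
    qed
    have eU: "expectation ?u \<le> expectation U" "expectation U - 1 / real n \<le> expectation ?u"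
      "0 \<le> expectation ?u" "expectation U \<le> 1"
    proof -
      show "expectation ?u \<le> expectation U" using iu iU u by (intro integral_mono) auto
      have "expectation (\<lambda>\<omega>. U \<omega> - 1 / real n) \<le> expectation ?u"
        using iu iU u by (intro integral_mono) auto
      then show "expectation U - 1 / real n \<le> expectation ?u" using iU by (simp add: prob_space)
      show "0 \<le> expectation ?u" using u by simp
      have "expectation U \<le> expectation (\<lambda>_. 1)" using iU U01 by (intro integral_mono) auto
      then show "expectation U \<le> 1" by (simp add: prob_space)
    qed
    have eV: "expectation ?v \<le> expectation V" "expectation V - 1 / real n \<le> expectation ?v"
      "0 \<le> expectation ?v" "expectation V \<le> 1"
    proof -
      show "expectation ?v \<le> expectation V" using iv iV v by (intro integral_mono) auto
      have "expectation (\<lambda>\<omega>. V \<omega> - 1 / real n) \<le> expectation ?v"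
        using iv iV v by (intro integral_mono) auto
      then show "expectation V - 1 / real n \<le> expectation ?v" using iV by (simp add: prob_space)
      show "0 \<le> expectation ?v" using v by simp
      have "expectation V \<le> expectation (\<lambda>_. 1)" using iV V01 by (intro integral_mono) auto
      then show "expectation V \<le> 1" by (simp add: prob_space)
    qed
    have d2: "\<bar>expectation U * expectation V - expectation ?u * expectation ?v\<bar> \<le> 2 / real n"
    proof -
      have "expectation U * expectation V - expectation ?u * expectation ?v
        = expectation U * (expectation V - expectation ?v) + (expectation U - expectation ?u) * expectation ?v"
        by (simp add: algebra_simps)
      moreover have "expectation U * (expectation V - expectation ?v) \<le> 1 * (1 / real n)"
        using eU eV by (intro mult_mono) auto
      moreover have "(expectation U - expectation ?u) * expectation ?v \<le> (1 / real n) * 1"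
        using eU eV by (intro mult_mono) auto
      moreover have "0 \<le> expectation U * (expectation V - expectation ?v)"
        "0 \<le> (expectation U - expectation ?u) * expectation ?v"
        using eU eV by (auto intro!: mult_nonneg_nonneg)
      ultimately show ?thesis by linarith
    qed
    have "2 / real n + 2 / real n = 4 / real n" by simp
    with step_cov d1 d2 show ?thesis by linarith
  qed
  have "(\<lambda>n. \<alpha> + 4 / real n) \<longlonglongrightarrow> \<alpha> + 0"
    by (intro tendsto_add tendsto_const lim_const_over_n)
  then show ?thesis
    using main by (intro LIMSEQ_le_const[where x = \<alpha>] exI[of _ 1]) auto
qed

lemma (in prob_space) covariance_le_mixing:
  fixes U V :: "'a \<Rightarrow> real"
  assumes F: "subalgebra M F" and G: "subalgebra M G"
    and U: "U \<in> borel_measurable F" and V: "V \<in> borel_measurable G"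
    and "B > 0" and UB: "\<And>\<omega>. \<bar>U \<omega>\<bar> \<le> B" and VB: "\<And>\<omega>. \<bar>V \<omega>\<bar> \<le> B"
    and mix: "\<And>A B. A \<in> sets F \<Longrightarrow> B \<in> sets G \<Longrightarrow> \<bar>prob (A \<inter> B) - prob A * prob B\<bar> \<le> \<alpha>"
  shows "\<bar>expectation (\<lambda>\<omega>. U \<omega> * V \<omega>) - expectation U * expectation V\<bar> \<le> 4 * B\<^sup>2 * \<alpha>"
proof -
  have [measurable]: "U \<in> borel_measurable M" "V \<in> borel_measurable M"
    using measurable_from_subalg F G U V by blast+
  define u where "u \<omega> = (U \<omega> + B) / (2 * B)" for \<omega>
  define v where "v \<omega> = (V \<omega> + B) / (2 * B)" for \<omega>
  have [measurable]: "u \<in> borel_measurable M" "v \<in> borel_measurable M"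
    unfolding u_def v_def by measurable
  have u01: "0 \<le> u \<omega> \<and> u \<omega> \<le> 1" and v01: "0 \<le> v \<omega> \<and> v \<omega> \<le> 1" for \<omega>
    using UB[of \<omega>] VB[of \<omega>] \<open>B > 0\<close> by (auto simp: u_def v_def field_simps)
  have cov: "\<bar>expectation (\<lambda>\<omega>. u \<omega> * v \<omega>) - expectation u * expectation v\<bar> \<le> \<alpha>"
  proof (rule covariance_le_mixing_unit[OF F G _ _ u01 v01 mix])
    show "u \<in> borel_measurable F" "v \<in> borel_measurable G"
      using U V unfolding u_def v_def by measurable
  qed
  have iu: "integrable M u" and iv: "integrable M v"
    using u01 v01 by (auto intro!: integrable_const_bound[of _ 1])
  have iuv: "integrable M (\<lambda>\<omega>. u \<omega> * v \<omega>)"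
    using u01 v01 by (auto intro!: integrable_const_bound[of _ 1] simp: abs_mult mult_le_one)
  have Ueq: "U = (\<lambda>\<omega>. 2 * B * u \<omega> - B)" and Veq: "V = (\<lambda>\<omega>. 2 * B * v \<omega> - B)"
    using \<open>B > 0\<close> by (auto simp: u_def v_def field_simps)
  have "expectation (\<lambda>\<omega>. U \<omega> * V \<omega>)
    = expectation (\<lambda>\<omega>. 4 * B\<^sup>2 * (u \<omega> * v \<omega>) - 2 * B\<^sup>2 * u \<omega> - 2 * B\<^sup>2 * v \<omega> + B\<^sup>2)"
    unfolding Ueq Veq
    by (intro Bochner_Integration.integral_cong refl) (simp add: algebra_simps power2_eq_square)
  also have "\<dots> = 4 * B\<^sup>2 * expectation (\<lambda>\<omega>. u \<omega> * v \<omega>) - 2 * B\<^sup>2 * expectation u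
      - 2 * B\<^sup>2 * expectation v + B\<^sup>2"
    using iu iv iuv by (simp add: prob_space)
  finally have EUV: "expectation (\<lambda>\<omega>. U \<omega> * V \<omega>) = \<dots>" .
  have EU: "expectation U = 2 * B * expectation u - B" and EV: "expectation V = 2 * B * expectation v - B"
    unfolding Ueq Veq using iu iv by (simp_all add: prob_space)
  have "expectation (\<lambda>\<omega>. U \<omega> * V \<omega>) - expectation U * expectation V
    = 4 * B\<^sup>2 * (expectation (\<lambda>\<omega>. u \<omega> * v \<omega>) - expectation u * expectation v)"
    unfolding EUV EU EV by (simp add: algebra_simps power2_eq_square)
  then show ?thesis
    using mult_left_mono[OF cov, of "4 * B\<^sup>2"] by (simp add: abs_mult)
qed

section \<open>The cocycle and the increments of the variance\<close>

lemma shift_funpow_apply: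
  assumes "m \<ge> 1"
  shows "(shift ^^ r) \<omega> m = \<omega> (m + r)"
  using assms by (induction r arbitrary: m) (auto simp: shift_def)

lemma cocycle_cong:
  assumes "\<And>m. 1 \<le> m \<Longrightarrow> m \<le> n \<Longrightarrow> \<omega> m = \<omega>' m"
  shows "cocycle T n \<omega> = cocycle T n \<omega>'"
  using assms by (induction n) auto

lemma cocycle_add:
  "cocycle T m ((shift ^^ r) \<omega>) (cocycle T r \<omega> x) = cocycle T (m + r) \<omega> x"
  by (induction m) (auto simp: shift_funpow_apply)

lemma covar_cong:
  assumes "\<And>m. 1 \<le> m \<Longrightarrow> m \<le> max i j \<Longrightarrow> \<omega> m = \<omega>' m"
  shows "covar T \<mu> f i j \<omega> = covar T \<mu> f i j \<omega>'"
proof -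
  have "cocycle T i \<omega> = cocycle T i \<omega>'" "cocycle T j \<omega> = cocycle T j \<omega>'"
    using assms by (auto intro!: cocycle_cong)
  then show ?thesis by (simp add: covar_def f_bar_def)
qed

lemma covar_commute: "covar T \<mu> f i j \<omega> = covar T \<mu> f j i \<omega>"
  by (simp add: covar_def mult.commute)

text \<open>
  The amount by which \<open>n \<sigma>\<^sub>n\<^sup>2\<close> grows when \<open>n\<close> increases from \<open>k\<close> to \<open>k + 1\<close>.  Collecting the
  covariances at their larger index makes the \<open>k\<close>-th increment a function of the coordinates
  \<open>1, \<dots>, k\<close> alone, whereas collecting them at the smaller index would involve the whole future.
\<close>
definition variance_increment ::
    "('w \<Rightarrow> 'x \<Rightarrow> 'x) \<Rightarrow> 'x measure \<Rightarrow> ('x \<Rightarrow> real) \<Rightarrow> nat \<Rightarrow> (nat \<Rightarrow> 'w) \<Rightarrow> real" where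
  "variance_increment T \<mu> f k \<omega> = (\<Sum>i\<le>k. (if i = k then 1 else 2) * covar T \<mu> f i k \<omega>)"

lemma sigma_sq_eq_increments:
  "sigma_sq T \<mu> f n \<omega> = (1 / real n) * (\<Sum>k<n. variance_increment T \<mu> f k \<omega>)"
proof -
  have "(\<Sum>i<n. \<Sum>j<n. covar T \<mu> f i j \<omega>) = (\<Sum>k<n. variance_increment T \<mu> f k \<omega>)"
  proof (induction n)
    case (Suc n)
    have "variance_increment T \<mu> f n \<omega> = covar T \<mu> f n n \<omega> + 2 * (\<Sum>i<n. covar T \<mu> f i n \<omega>)"
      by (simp add: variance_increment_def sum_distrib_left flip: lessThan_Suc_atMost)
    moreover have "(\<Sum>j<n. covar T \<mu> f n j \<omega>) = (\<Sum>i<n. covar T \<mu> f i n \<omega>)"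
      by (intro sum.cong refl covar_commute)
    ultimately show ?case
      using Suc by (simp add: sum.distrib)
  qed simp
  then show ?thesis by (simp add: sigma_sq_def)
qed

section \<open>Measurability with respect to past and future coordinates\<close>

definition coord_space :: "'w measure \<Rightarrow> nat set \<Rightarrow> (nat \<Rightarrow> 'w) measure" where
  "coord_space E I = sigma (PiE {1..} (\<lambda>_. space E))
     {{\<omega> \<in> PiE {1..} (\<lambda>_. space E). \<omega> m \<in> S} | m S. m \<in> I \<and> S \<in> sets E}"

lemma space_coord_space [simp]: "space (coord_space E I) = PiE {1..} (\<lambda>_. space E)"
  unfolding coord_space_def by (rule space_measure_of) auto

lemma sets_coord_space [simp]: "sets (coord_space E I) = coord_algebra E I"
  unfolding coord_space_def coord_algebra_def by (rule sets_measure_of) auto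

lemma coord_measurable:
  assumes "m \<in> I" "m \<ge> 1"
  shows "(\<lambda>\<omega>. \<omega> m) \<in> measurable (coord_space E I) E"
proof (rule measurableI)
  fix S assume "S \<in> sets E"
  then have "{\<omega> \<in> PiE {1..} (\<lambda>_. space E). \<omega> m \<in> S} \<in> coord_algebra E I"
    using assms unfolding coord_algebra_def by (intro sigma_sets.Basic) blast
  moreover have "(\<lambda>\<omega>. \<omega> m) -` S \<inter> space (coord_space E I) = {\<omega> \<in> PiE {1..} (\<lambda>_. space E). \<omega> m \<in> S}"
    by auto
  ultimately show "(\<lambda>\<omega>. \<omega> m) -` S \<inter> space (coord_space E I) \<in> sets (coord_space E I)"
    by simp
qed (use assms in auto)

context random_dynamics
begin

lemma space_P: "space P = PiE {1..} (\<lambda>_. space E)"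
  using sets_eq_imp_space_eq[OF sets_P] by (simp add: space_PiM)

lemma subalgebra_coord_space:
  assumes "I \<subseteq> {1..}"
  shows "subalgebra P (coord_space E I)"
  unfolding subalgebra_def
proof (intro conjI)
  show "space (coord_space E I) = space P" by (simp add: space_P)
  have "{\<omega> \<in> PiE {1..} (\<lambda>_. space E). \<omega> m \<in> S} \<in> sets P" if "m \<in> I" "S \<in> sets E" for m S
  proof -
    have "(\<lambda>\<omega>. \<omega> m) \<in> measurable P E"
      unfolding measurable_cong_sets[OF sets_P refl]
      using that assms by (intro measurable_component_singleton) auto
    from measurable_sets[OF this that(2)] show ?thesis
      by (simp add: space_P vimage_def Int_def conj_commute)
  qed
  then show "sets (coord_space E I) \<subseteq> sets P"
    unfolding sets_coord_space coord_algebra_def space_P[symmetric]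
    by (intro sets.sigma_sets_subset) (auto simp: space_P)
qed

lemma shift_funpow_measurable:
  assumes "{r + 1..} \<subseteq> I"
  shows "(shift ^^ r) \<in> measurable (coord_space E I) P"
proof -
  have "(\<lambda>\<omega>. \<lambda>m\<in>{1..}. \<omega> (m + r)) \<in> measurable (coord_space E I) (PiM {1..} (\<lambda>_. E))"
    using assms by (intro measurable_restrict coord_measurable) auto
  moreover have eq: "(shift ^^ r) \<omega> = (\<lambda>m\<in>{1..}. \<omega> (m + r))" if "\<omega> \<in> space (coord_space E I)" for \<omega>
  proof
    fix m
    show "(shift ^^ r) \<omega> m = (\<lambda>m\<in>{1..}. \<omega> (m + r)) m"
    proof (cases "m \<ge> 1")
      case True
      then show ?thesis by (simp add: shift_funpow_apply)
    next
      case False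
      then show ?thesis using that by (cases r) (auto simp: shift_def)
    qed
  qed
  ultimately show ?thesis
    unfolding measurable_cong_sets[OF refl sets_P] by (subst measurable_cong[OF eq])
qed

lemma shift_funpow_space: "\<omega> \<in> space P \<Longrightarrow> (shift ^^ r) \<omega> \<in> space P"
  using measurable_space[OF shift_funpow_measurable[of r UNIV]] by (simp add: space_P)

lemma observable_measurable: "(\<lambda>(\<omega>, x). f (cocycle T i \<omega> x)) \<in> borel_measurable (P \<Otimes>\<^sub>M \<mu>)"
  using measurable_compose[OF cocycle_measurable f_measurable] by (simp add: case_prod_unfold)

lemma observable_section_measurable:
  assumes "\<omega> \<in> space P"
  shows "(\<lambda>x. f (cocycle T i \<omega> x)) \<in> borel_measurable \<mu>"
  using measurable_Pair2[OF observable_measurable assms] by simp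

lemma cocycle_in_space:
  assumes "\<omega> \<in> space P" "x \<in> space \<mu>"
  shows "cocycle T i \<omega> x \<in> space \<mu>"
  using measurable_space[OF cocycle_measurable, of "(\<omega>, x)" i] assms by (simp add: space_pair_measure)

text \<open>
  Stated for a general map \<open>h\<close> so that it can be applied to two maps that are measurable for smaller
  sigma-algebras: forgetting the coordinates after time \<open>k\<close>, and iterated shifts.
\<close>
lemma covar_measurable_comp:
  assumes h: "h \<in> measurable N P"
  shows "(\<lambda>\<omega>. covar T \<mu> f i j (h \<omega>)) \<in> borel_measurable N"
proof -
  have obs: "(\<lambda>(\<omega>, x). f (cocycle T i (h \<omega>) x)) \<in> borel_measurable (N \<Otimes>\<^sub>M \<mu>)" for i
  proof -
    have "(\<lambda>(\<omega>, x). (h \<omega>, x)) \<in> measurable (N \<Otimes>\<^sub>M \<mu>) (P \<Otimes>\<^sub>M \<mu>)"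
      using h by measurable
    from measurable_compose[OF this observable_measurable, of i] show ?thesis
      by (simp add: case_prod_unfold)
  qed
  have mean [measurable]: "(\<lambda>\<omega>. \<integral>x. f (cocycle T i (h \<omega>) x) \<partial>\<mu>) \<in> borel_measurable N" for i
    by (rule \<mu>.borel_measurable_lebesgue_integral) (rule obs)
  have [measurable]: "(\<lambda>p. f (cocycle T i (h (fst p)) (snd p))) \<in> borel_measurable (N \<Otimes>\<^sub>M \<mu>)" for i
    using obs[of i] by (simp add: case_prod_unfold)
  show ?thesis
    unfolding covar_def f_bar_def
    by (rule \<mu>.borel_measurable_lebesgue_integral) (simp add: case_prod_unfold)
qed

text \<open>
  The joint measurability of the cocycle refers to the full product sigma-algebra.  Replacing all
  coordinates after time \<open>k\<close> by those of a fixed sequence leaves the covariance unchanged and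
  factors it through a map that is measurable with respect to the past.
\<close>
lemma covar_past_measurable:
  assumes "i \<le> k" "j \<le> k"
  shows "covar T \<mu> f i j \<in> borel_measurable (coord_space E {1..k})"
proof -
  obtain \<omega>\<^sub>0 where \<omega>\<^sub>0: "\<omega>\<^sub>0 \<in> space P" using P.not_empty by blast
  define cut where "cut \<omega> = (\<lambda>m\<in>{1..}. if m \<le> k then \<omega> m else \<omega>\<^sub>0 m)" for \<omega>
  have "cut \<in> measurable (coord_space E {1..k}) (PiM {1..} (\<lambda>_. E))"
    unfolding cut_def
  proof (rule measurable_restrict)
    fix m :: nat assume "m \<in> {1..}"
    then show "(\<lambda>\<omega>. if m \<le> k then \<omega> m else \<omega>\<^sub>0 m) \<in> measurable (coord_space E {1..k}) E"
      using \<omega>\<^sub>0 by (cases "m \<le> k") (auto intro!: coord_measurable measurable_const simp: space_P)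
  qed
  then have "cut \<in> measurable (coord_space E {1..k}) P"
    unfolding measurable_cong_sets[OF refl sets_P] .
  from covar_measurable_comp[OF this, of i j]
  have "(\<lambda>\<omega>. covar T \<mu> f i j (cut \<omega>)) \<in> borel_measurable (coord_space E {1..k})" .
  moreover have "covar T \<mu> f i j (cut \<omega>) = covar T \<mu> f i j \<omega>" for \<omega>
    using assms by (intro covar_cong) (auto simp: cut_def)
  ultimately show ?thesis by simp
qed

lemma variance_increment_measurable:
  assumes "k \<le> m"
  shows "variance_increment T \<mu> f k \<in> borel_measurable (coord_space E {1..m})"
  using assms
  unfolding variance_increment_def[abs_def]
  by (intro borel_measurable_sum borel_measurable_times borel_measurable_const covar_past_measurable) auto

section \<open>Loss of memory\<close>

lemma variance_increment_bound:
  assumes cov: "\<And>i j. \<bar>covar T \<mu> f i j \<omega>\<bar> \<le> \<eta> (nat \<bar>int i - int j\<bar>)"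
    and "\<And>n. 0 \<le> \<eta> n" "summable \<eta>"
  shows "\<bar>variance_increment T \<mu> f k \<omega>\<bar> \<le> 2 * (\<Sum>d. \<eta> d)"
proof -
  have "\<bar>variance_increment T \<mu> f k \<omega>\<bar> \<le> (\<Sum>i\<le>k. 2 * \<eta> (k - i))"
    unfolding variance_increment_def
  proof (intro order_trans[OF sum_abs] sum_mono)
    fix i assume "i \<in> {..k}"
    then have "\<bar>covar T \<mu> f i k \<omega>\<bar> \<le> \<eta> (k - i)"
      using cov[of i k] by (simp add: nat_diff_distrib' abs_if split: if_splits)
    then show "\<bar>(if i = k then 1 else 2) * covar T \<mu> f i k \<omega>\<bar> \<le> 2 * \<eta> (k - i)"
      by (auto simp: abs_mult)
  qed
  also have "\<dots> = 2 * (\<Sum>i\<le>k. \<eta> (k - i))" by (simp add: sum_distrib_left)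
  also have "(\<Sum>i\<le>k. \<eta> (k - i)) \<le> (\<Sum>d. \<eta> (d + 0))"
    using assms by (intro sum_le_tail) (auto simp: inj_on_def)
  finally show ?thesis by simp
qed

text \<open>
  Loss of memory: starting the dynamics at time \<open>r\<close> instead of \<open>0\<close>, again from \<open>\<mu>\<close>, changes the
  covariance by at most a constant multiple of \<open>\<eta> (i - r)\<close>.  The product moment and both means
  are integrals of one test function each, evaluated at time \<open>i\<close>: for \<open>m = l - i\<close> these are
  \<open>f \<cdot> (f \<circ> \<phi> m)\<close>, \<open>f\<close> and \<open>f \<circ> \<phi> m\<close>.
\<close>
lemma covar_shift_approx:
  assumes \<omega>: "\<omega> \<in> space P" and K: "\<And>x. x \<in> space \<mu> \<Longrightarrow> \<bar>f x\<bar> \<le> K"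
    and memory: "\<And>k r g. r \<le> k \<Longrightarrow> g \<in> test_functions T f ((shift ^^ k) \<omega>) \<Longrightarrow>
      \<bar>(\<integral>x. g (cocycle T k \<omega> x) \<partial>\<mu>) - (\<integral>x. g (cocycle T (k - r) ((shift ^^ r) \<omega>) x) \<partial>\<mu>)\<bar> \<le> C * \<eta> (k - r)"
    and "r \<le> i" "i \<le> l"
  shows "\<bar>covar T \<mu> f i l \<omega> - covar T \<mu> f (i - r) (l - r) ((shift ^^ r) \<omega>)\<bar>
    \<le> (1 + 2 * K) * (C * \<eta> (i - r))"
proof -
  define \<omega>' where "\<omega>' = (shift ^^ r) \<omega>"
  define m where "m = l - i"
  define a where "a j \<omega> = (\<integral>x. f (cocycle T j \<omega> x) \<partial>\<mu>)" for j \<omega>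
  define b where "b i j \<omega> = (\<integral>x. f (cocycle T i \<omega> x) * f (cocycle T j \<omega> x) \<partial>\<mu>)" for i j \<omega>
  have \<omega>': "\<omega>' \<in> space P" unfolding \<omega>'_def by (rule shift_funpow_space[OF \<omega>])
  have int1: "integrable \<mu> (\<lambda>x. f (cocycle T j z x))" if "z \<in> space P" for j z
    using observable_section_measurable[OF that] K cocycle_in_space[OF that]
    by (intro \<mu>.integrable_const_bound[of _ K]) auto
  have int2: "integrable \<mu> (\<lambda>x. f (cocycle T i z x) * f (cocycle T j z x))" if "z \<in> space P" for i j z
    using observable_section_measurable[OF that] K cocycle_in_space[OF that]
    by (intro \<mu>.integrable_const_bound[of _ "K * K"])
      (auto simp: abs_mult intro!: mult_mono AE_I2 order_trans[OF abs_ge_zero])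
  have covar_eq: "covar T \<mu> f i j z = b i j z - a i z * a j z" if "z \<in> space P" for i j z
  proof -
    have "covar T \<mu> f i j z = (\<integral>x. f (cocycle T i z x) * f (cocycle T j z x)
        - a j z * f (cocycle T i z x) - a i z * f (cocycle T j z x) + a i z * a j z \<partial>\<mu>)"
      unfolding covar_def f_bar_def a_def by (intro Bochner_Integration.integral_cong refl) (simp add: algebra_simps)
    also have "\<dots> = b i j z - a j z * a i z - a i z * a j z + a i z * a j z"
      using int1[OF that] int2[OF that] by (simp add: \<mu>.prob_space a_def b_def)
    finally show ?thesis by (simp add: mult.commute)
  qed
  have aK: "\<bar>a j z\<bar> \<le> K" if "z \<in> space P" for j z
    unfolding a_def using int1[OF that] K cocycle_in_space[OF that]
    by (intro \<mu>.abs_expectation_le) auto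
  have sh: "(shift ^^ i) \<omega> = (shift ^^ (i - r)) \<omega>'"
    unfolding \<omega>'_def using \<open>r \<le> i\<close>
    by (metis comp_apply funpow_add le_add_diff_inverse2)
  have fi: "f \<in> test_functions T f ((shift ^^ i) \<omega>)"
    unfolding test_functions_def by (intro UnI1 range_eqI[of _ _ 0]) auto
  have fl: "f \<circ> cocycle T m ((shift ^^ i) \<omega>) \<in> test_functions T f ((shift ^^ i) \<omega>)"
    and fil: "(\<lambda>x. f x * f (cocycle T m ((shift ^^ i) \<omega>) x)) \<in> test_functions T f ((shift ^^ i) \<omega>)"
    unfolding test_functions_def by auto
  have c1: "cocycle T m ((shift ^^ i) \<omega>) (cocycle T i \<omega> x) = cocycle T l \<omega> x" for x
    using \<open>i \<le> l\<close> by (simp add: cocycle_add m_def)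
  have c2: "cocycle T m ((shift ^^ i) \<omega>) (cocycle T (i - r) \<omega>' x) = cocycle T (l - r) \<omega>' x" for x
    unfolding sh cocycle_add using assms by (simp add: m_def)
  let ?e = "C * \<eta> (i - r)"
  have d1: "\<bar>a i \<omega> - a (i - r) \<omega>'\<bar> \<le> ?e"
    using memory[OF \<open>r \<le> i\<close> fi] by (simp add: a_def \<omega>'_def)
  have d2: "\<bar>a l \<omega> - a (l - r) \<omega>'\<bar> \<le> ?e"
    using memory[OF \<open>r \<le> i\<close> fl] unfolding \<omega>'_def[symmetric] by (simp add: a_def c1 c2)
  have d3: "\<bar>b i l \<omega> - b (i - r) (l - r) \<omega>'\<bar> \<le> ?e"
    using memory[OF \<open>r \<le> i\<close> fil] unfolding \<omega>'_def[symmetric] by (simp add: b_def c1 c2)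
  have "a i \<omega> * a l \<omega> - a (i - r) \<omega>' * a (l - r) \<omega>'
    = a i \<omega> * (a l \<omega> - a (l - r) \<omega>') + (a i \<omega> - a (i - r) \<omega>') * a (l - r) \<omega>'"
    by (simp add: algebra_simps)
  moreover have "\<bar>a i \<omega> * (a l \<omega> - a (l - r) \<omega>')\<bar> \<le> K * ?e"
    unfolding abs_mult using aK[OF \<omega>, of i] d2 by (intro mult_mono) auto
  moreover have "\<bar>(a i \<omega> - a (i - r) \<omega>') * a (l - r) \<omega>'\<bar> \<le> ?e * K"
    unfolding abs_mult using aK[OF \<omega>', of "l - r"] d1 by (intro mult_mono) auto
  ultimately have "\<bar>(b i l \<omega> - a i \<omega> * a l \<omega>) - (b (i - r) (l - r) \<omega>' - a (i - r) \<omega>' * a (l - r) \<omega>')\<bar>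
    \<le> ?e + K * ?e + ?e * K"
    using d3 by linarith
  also have "\<dots> = (1 + 2 * K) * ?e" by (simp add: algebra_simps)
  finally show ?thesis
    unfolding \<omega>'_def[symmetric] covar_eq[OF \<omega>] covar_eq[OF \<omega>'] .
qed

text \<open>
  The approximation to the \<open>l\<close>-th variance increment that depends only on the coordinates after
  time \<open>r\<close>: covariances with first index up to \<open>s\<close> are dropped, and the others are computed for the
  dynamics restarted at time \<open>r\<close>.
\<close>
definition future_increment :: "nat \<Rightarrow> nat \<Rightarrow> nat \<Rightarrow> (nat \<Rightarrow> 'w) \<Rightarrow> real" where
  "future_increment r s l \<omega> =
     (\<Sum>i\<in>{s<..l}. (if i = l then 1 else 2) * covar T \<mu> f (i - r) (l - r) ((shift ^^ r) \<omega>))"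

lemma future_increment_measurable:
  "future_increment r s l \<in> borel_measurable (coord_space E {r + 1..})"
  unfolding future_increment_def[abs_def]
  by (intro borel_measurable_sum borel_measurable_times borel_measurable_const
      covar_measurable_comp shift_funpow_measurable) auto

text \<open>
  The dropped covariances have index difference at least \<open>l - s\<close> and are small by decay of
  correlations; the others are replaced at times \<open>i > s\<close> and change little by loss of memory over
  \<open>i - r\<close> steps.  Both differences are at least \<open>p\<close>, so both errors are bounded by the same tail.
\<close>
lemma increment_decoupling:
  assumes \<omega>: "\<omega> \<in> space P" and K: "\<And>x. x \<in> space \<mu> \<Longrightarrow> \<bar>f x\<bar> \<le> K"
    and cov: "\<And>i j. \<bar>covar T \<mu> f i j \<omega>\<bar> \<le> \<eta> (nat \<bar>int i - int j\<bar>)"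
    and memory: "\<And>k r g. r \<le> k \<Longrightarrow> g \<in> test_functions T f ((shift ^^ k) \<omega>) \<Longrightarrow>
      \<bar>(\<integral>x. g (cocycle T k \<omega> x) \<partial>\<mu>) - (\<integral>x. g (cocycle T (k - r) ((shift ^^ r) \<omega>) x) \<partial>\<mu>)\<bar> \<le> C * \<eta> (k - r)"
    and \<eta>: "\<And>n. 0 \<le> \<eta> n" "summable \<eta>" and "C \<ge> 0" "K \<ge> 0"
    and sl: "s + p \<le> l" and rs: "r + p \<le> s + 1"
  shows "\<bar>variance_increment T \<mu> f l \<omega> - future_increment r s l \<omega>\<bar>
    \<le> 2 * (1 + (1 + 2 * K) * C) * (\<Sum>d. \<eta> (d + p))"
proof -
  let ?c = "\<lambda>i. if i = l then 1 else 2 :: real"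
  let ?G = "\<Sum>d. \<eta> (d + p)"
  have split: "{..l} = {..s} \<union> {s<..l}" using sl by auto
  have "variance_increment T \<mu> f l \<omega>
    = (\<Sum>i\<le>s. ?c i * covar T \<mu> f i l \<omega>) + (\<Sum>i\<in>{s<..l}. ?c i * covar T \<mu> f i l \<omega>)"
    unfolding variance_increment_def split by (rule sum.union_disjoint) auto
  then have eq: "variance_increment T \<mu> f l \<omega> - future_increment r s l \<omega>
    = (\<Sum>i\<le>s. ?c i * covar T \<mu> f i l \<omega>)
      + (\<Sum>i\<in>{s<..l}. ?c i * (covar T \<mu> f i l \<omega> - covar T \<mu> f (i - r) (l - r) ((shift ^^ r) \<omega>)))"
    by (simp add: future_increment_def sum_subtractf right_diff_distrib)
  have "\<bar>\<Sum>i\<le>s. ?c i * covar T \<mu> f i l \<omega>\<bar> \<le> (\<Sum>i\<le>s. 2 * \<eta> (l - i))"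
  proof (intro order_trans[OF sum_abs] sum_mono)
    fix i assume "i \<in> {..s}"
    then have "\<bar>covar T \<mu> f i l \<omega>\<bar> \<le> \<eta> (l - i)"
      using cov[of i l] sl by (simp add: nat_diff_distrib' abs_if split: if_splits)
    then show "\<bar>?c i * covar T \<mu> f i l \<omega>\<bar> \<le> 2 * \<eta> (l - i)"
      by (auto simp: abs_mult)
  qed
  also have "\<dots> = 2 * (\<Sum>i\<le>s. \<eta> (l - i))" by (simp add: sum_distrib_left)
  also have "(\<Sum>i\<le>s. \<eta> (l - i)) \<le> ?G"
    using \<eta> sl by (intro sum_le_tail) (auto simp: inj_on_def)
  finally have old: "\<bar>\<Sum>i\<le>s. ?c i * covar T \<mu> f i l \<omega>\<bar> \<le> 2 * ?G" by simp
  have "\<bar>\<Sum>i\<in>{s<..l}. ?c i * (covar T \<mu> f i l \<omega> - covar T \<mu> f (i - r) (l - r) ((shift ^^ r) \<omega>))\<bar>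
    \<le> (\<Sum>i\<in>{s<..l}. 2 * ((1 + 2 * K) * (C * \<eta> (i - r))))"
  proof (intro order_trans[OF sum_abs] sum_mono)
    fix i assume "i \<in> {s<..l}"
    then have "r \<le> i" "i \<le> l" using rs by auto
    note covar_shift_approx[OF \<omega> K memory this]
    moreover have "0 \<le> (1 + 2 * K) * (C * \<eta> (i - r))"
      using \<eta> \<open>C \<ge> 0\<close> \<open>K \<ge> 0\<close> by auto
    ultimately show "\<bar>?c i * (covar T \<mu> f i l \<omega> - covar T \<mu> f (i - r) (l - r) ((shift ^^ r) \<omega>))\<bar>
      \<le> 2 * ((1 + 2 * K) * (C * \<eta> (i - r)))"
      by (auto simp: abs_mult)
  qed
  also have "\<dots> = 2 * ((1 + 2 * K) * C) * (\<Sum>i\<in>{s<..l}. \<eta> (i - r))"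
    by (simp add: sum_distrib_left mult.assoc)
  also have "\<dots> \<le> 2 * ((1 + 2 * K) * C) * ?G"
    using \<eta> rs \<open>C \<ge> 0\<close> \<open>K \<ge> 0\<close>
    by (intro mult_left_mono sum_le_tail) (auto simp: inj_on_def eq_diff_iff)
  finally show ?thesis using old unfolding eq by (simp add: algebra_simps)
qed

section \<open>Decay of correlations of the increments\<close>

lemma mixing_bound:
  assumes "SA2 E P \<alpha>" "i \<ge> 1" "n \<ge> 1"
    and A: "A \<in> coord_algebra E {1..i}" and B: "B \<in> coord_algebra E {i + n..}"
  shows "\<bar>P.prob (A \<inter> B) - P.prob A * P.prob B\<bar> \<le> \<alpha> n"
proof -
  define h where "h = (\<lambda>(A, B). \<bar>P.prob (A \<inter> B) - P.prob A * P.prob B\<bar>)"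
  have h1: "h z \<le> 1" for z
  proof (cases z)
    case (Pair A B)
    have "P.prob A * P.prob B \<le> 1" by (simp add: mult_le_one)
    moreover have "0 \<le> P.prob A * P.prob B" by simp
    ultimately show ?thesis
      using P.prob_le_1[of "A \<inter> B"] measure_nonneg[of P "A \<inter> B"] 
      unfolding h_def Pair prod.case abs_le_iff by linarith
  qed
  let ?D = "\<lambda>i. coord_algebra E {1..i} \<times> coord_algebra E {i + n..}"
  have ne: "?D i \<noteq> {}" for i
    by (auto simp: coord_algebra_def intro: sigma_sets.Empty)
  have inner: "(SUP z\<in>?D i. h z) \<le> 1" for i
    using ne h1 by (intro cSUP_least) auto
  have "h (A, B) \<le> (SUP z\<in>?D i. h z)"
    using A B h1 by (intro cSUP_upper bdd_aboveI2[where M = 1]) auto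
  also have "\<dots> \<le> (SUP i\<in>{1..}. SUP z\<in>?D i. h z)"
    using inner \<open>i \<ge> 1\<close> by (intro cSUP_upper bdd_aboveI2[where M = 1]) auto
  also have "\<dots> = mixing_coeff E P n" by (simp add: mixing_coeff_def h_def)
  also have "\<dots> \<le> \<alpha> n" using assms by (simp add: SA2_def)
  finally show ?thesis by (simp add: h_def)
qed

text \<open>
  The gap between \<open>k\<close> and \<open>l\<close> is divided into three parts of length about \<open>p = (l - k) div 3\<close>: the
  first separates the past of the \<open>k\<close>-th increment from the restart time \<open>r\<close> and yields the mixing
  rate \<open>p ^ -\<gamma>\<close>, the second is the time from \<open>r\<close> to \<open>s\<close> for losing memory, the third lets the
  covariances of times before \<open>s\<close> with time \<open>l\<close> decay.  The last two yield the summed rate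
  \<open>p ^ (1 - \<psi>)\<close>.
\<close>
lemma increment_correlation_decay:
  assumes \<beta>: "\<beta> > 0" "\<beta> \<le> \<psi> - 1" "\<beta> \<le> \<gamma>"
    and SA1: "SA1 P T \<mu> f (power_decay A \<psi>)" and SA2: "SA2 E P (power_decay A' \<gamma>)"
    and SA3: "SA3 P T \<mu> f (power_decay A \<psi>)"
  defines "w \<equiv> variance_increment T \<mu> f"
  shows "\<exists>B. \<forall>k. AE \<omega> in P. \<bar>w k \<omega>\<bar> \<le> B"
    and "\<exists>D\<ge>0. \<forall>k l. k \<le> l \<longrightarrow>
      \<bar>P.expectation (\<lambda>\<omega>. w k \<omega> * w l \<omega>) - P.expectation (w k) * P.expectation (w l)\<bar>
        \<le> D * real (Suc (l - k)) powr (- \<beta>)"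
proof -
  define \<eta> where "\<eta> = power_decay A \<psi>"
  have \<eta>: "\<And>n. 0 \<le> \<eta> n" "summable \<eta>"
    and cov: "AE \<omega> in P. \<forall>i j. \<bar>covar T \<mu> f i j \<omega>\<bar> \<le> \<eta> (nat \<bar>int i - int j\<bar>)"
    using SA1 by (auto simp: SA1_def \<eta>_def)
  have A: "A \<ge> 0" using \<eta>(1)[of 0] by (simp add: \<eta>_def power_decay_def)
  obtain K where K: "\<And>x. x \<in> space \<mu> \<Longrightarrow> \<bar>f x\<bar> \<le> K" using f_bounded by blast
  obtain x\<^sub>0 where "x\<^sub>0 \<in> space \<mu>" using \<mu>.not_empty by blast
  with K have K0: "K \<ge> 0" by fastforce
  obtain C where C: "C \<ge> 0" and memory: "AE \<omega> in P. \<forall>k. \<forall>r\<le>k. \<forall>g\<in>test_functions T f ((shift ^^ k) \<omega>).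
        \<bar>(\<integral>x. g (cocycle T k \<omega> x) \<partial>\<mu>) - (\<integral>x. g (cocycle T (k - r) ((shift ^^ r) \<omega>) x) \<partial>\<mu>)\<bar> \<le> C * \<eta> (k - r)"
    using SA3 unfolding SA3_def \<eta>_def by blast
  obtain c where c: "c \<ge> 0" "\<And>p. (\<Sum>d. \<eta> (d + p)) \<le> c * real (Suc p) powr (1 - \<psi>)"
    using power_decay_tail[of \<psi> A] \<beta> A unfolding \<eta>_def by auto
  define M where "M = 2 * (\<Sum>d. \<eta> d) + 1"
  have M: "M > 0" using suminf_nonneg[OF \<eta>(2) \<eta>(1)] by (simp add: M_def)
  have w_bound: "AE \<omega> in P. \<forall>k. \<bar>w k \<omega>\<bar> \<le> M"
    using cov
  proof eventually_elim
    case (elim \<omega>)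
    then have "\<bar>w k \<omega>\<bar> \<le> 2 * (\<Sum>d. \<eta> d)" for k
      unfolding w_def using \<eta> by (intro variance_increment_bound) auto
    then show ?case unfolding M_def by (meson add_increasing2 zero_le_one)
  qed
  then show "\<exists>B. \<forall>k. AE \<omega> in P. \<bar>w k \<omega>\<bar> \<le> B"
    by (intro exI[of _ M] allI) (auto elim: eventually_mono)
  have wM [measurable]: "w k \<in> borel_measurable P" for k
    unfolding w_def
    using measurable_from_subalg[OF subalgebra_coord_space variance_increment_measurable[of k k]] by auto
  have A': "A' \<ge> 0"
    using mixing_bound[OF SA2, of 1 1 "{}" "{}"]
    by (simp add: power_decay_def coord_algebra_def sigma_sets.Empty)
  define c' where "c' = 2 * (1 + (1 + 2 * K) * C) * c"
  have c': "c' \<ge> 0" using c C K0 by (simp add: c'_def)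
  define D where "D = (4 * M\<^sup>2 * A' + 2 * M * c') * 3 powr \<beta>"
  have "\<bar>P.expectation (\<lambda>\<omega>. w k \<omega> * w l \<omega>) - P.expectation (w k) * P.expectation (w l)\<bar>
        \<le> D * real (Suc (l - k)) powr (- \<beta>)" if "k \<le> l" for k l
  proof -
    define p where "p = (l - k) div 3"
    define r where "r = k + p + 1"
    define s where "s = k + 2 * p"
    define err where "err = c' * real (Suc p) powr (1 - \<psi>)"
    have sl: "s + p \<le> l" and rs: "r + p \<le> s + 1"
      using \<open>k \<le> l\<close> by (auto simp: s_def r_def p_def)
    \<comment> \<open>The increments are bounded by \<open>M\<close> only almost surely, and their approximations may exceed \<open>M\<close>;\<close>
    \<comment> \<open>clipping both to \<open>[-M, M]\<close> does not increase their distance.\<close>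
    define clip where "clip x = max (- M) (min M x)" for x :: real
    have clip: "\<bar>clip x\<bar> \<le> M" for x using M by (auto simp: clip_def)
    have clip_meas [measurable]: "clip \<in> borel_measurable borel"
      unfolding clip_def[abs_def] by measurable
    define U where "U \<omega> = clip (w k \<omega>)" for \<omega>
    define V where "V \<omega> = clip (future_increment r s l \<omega>)" for \<omega>
    \<comment> \<open>\<open>{1..k + 1}\<close> rather than \<open>{1..k}\<close>, because \<open>k\<close> may be \<open>0\<close> and the mixing coefficients start with the past \<open>{1..1}\<close>.\<close>
    have U: "U \<in> borel_measurable (coord_space E {1..k + 1})"
      unfolding U_def[abs_def] w_def
      by (rule measurable_compose[OF variance_increment_measurable clip_meas]) simp
    have V: "V \<in> borel_measurable (coord_space E {k + 1 + Suc p..})"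
      unfolding V_def[abs_def]
      using measurable_compose[OF future_increment_measurable clip_meas] by (simp add: r_def)
    have subU: "subalgebra P (coord_space E {1..k + 1})"
      and subV: "subalgebra P (coord_space E {k + 1 + Suc p..})"
      by (auto intro!: subalgebra_coord_space)
    have [measurable]: "U \<in> borel_measurable P" "V \<in> borel_measurable P"
      using measurable_from_subalg subU subV U V by blast+
    have cov_UV: "\<bar>P.expectation (\<lambda>\<omega>. U \<omega> * V \<omega>) - P.expectation U * P.expectation V\<bar>
      \<le> 4 * M\<^sup>2 * power_decay A' \<gamma> (Suc p)"
    proof (rule P.covariance_le_mixing[OF subU subV U V M])
      show "\<bar>U \<omega>\<bar> \<le> M" "\<bar>V \<omega>\<bar> \<le> M" for \<omega>
        by (simp_all add: U_def V_def clip)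
      fix S S' assume "S \<in> sets (coord_space E {1..k + 1})" "S' \<in> sets (coord_space E {k + 1 + Suc p..})"
      then show "\<bar>P.prob (S \<inter> S') - P.prob S * P.prob S'\<bar> \<le> power_decay A' \<gamma> (Suc p)"
        using mixing_bound[OF SA2, of "k + 1" "Suc p" S S'] by simp
    qed
    have Uw: "AE \<omega> in P. U \<omega> = w k \<omega>"
      using w_bound
    proof eventually_elim
      case (elim \<omega>)
      then have "\<bar>w k \<omega>\<bar> \<le> M" by blast
      then show ?case by (auto simp: U_def clip_def)
    qed
    have Vw: "AE \<omega> in P. \<bar>w l \<omega> - V \<omega>\<bar> \<le> err"
      using w_bound cov memory AE_space
    proof eventually_elim
      case (elim \<omega>)
      have "\<bar>w l \<omega> - future_increment r s l \<omega>\<bar> \<le> 2 * (1 + (1 + 2 * K) * C) * (\<Sum>d. \<eta> (d + p))"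
        unfolding w_def
        by (rule increment_decoupling) (use elim K \<eta> C K0 sl rs in blast)+
      also have "\<dots> \<le> 2 * (1 + (1 + 2 * K) * C) * (c * real (Suc p) powr (1 - \<psi>))"
        using c(2)[of p] C K0 by (intro mult_left_mono) auto
      also have "\<dots> = err" by (simp add: err_def c'_def)
      finally have "\<bar>w l \<omega> - future_increment r s l \<omega>\<bar> \<le> err" .
      moreover have "\<bar>w l \<omega>\<bar> \<le> M" using elim by blast
      ultimately show ?case unfolding V_def clip_def by (auto simp: max_def min_def)
    qed
    have UB: "\<bar>U \<omega>\<bar> \<le> M" and VB: "\<bar>V \<omega>\<bar> \<le> M" for \<omega>
      by (simp_all add: U_def V_def clip)
    have iU: "integrable P U" and iV: "integrable P V" and iw: "integrable P (w l)"
      using UB VB w_bound by (auto intro!: P.integrable_const_bound[of _ M] elim: eventually_mono)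
    have iUV: "integrable P (\<lambda>\<omega>. U \<omega> * V \<omega>)"
      using UB VB M by (auto intro!: P.integrable_const_bound[of _ "M * M"] AE_I2 mult_mono simp: abs_mult)
    have iUw: "integrable P (\<lambda>\<omega>. U \<omega> * w l \<omega>)"
    proof (rule P.integrable_const_bound[of _ "M * M"])
      show "AE \<omega> in P. norm (U \<omega> * w l \<omega>) \<le> M * M"
        using w_bound by eventually_elim (use UB M in \<open>auto simp: abs_mult intro!: mult_mono\<close>)
    qed measurable
    let ?R = "\<lambda>\<omega>. w l \<omega> - V \<omega>"
    have EUR: "\<bar>P.expectation (\<lambda>\<omega>. U \<omega> * ?R \<omega>)\<bar> \<le> M * err"
    proof (rule P.abs_expectation_le)
      show "integrable P (\<lambda>\<omega>. U \<omega> * ?R \<omega>)" using iUV iUw by (simp add: right_diff_distrib)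
      show "AE \<omega> in P. \<bar>U \<omega> * ?R \<omega>\<bar> \<le> M * err"
        using Vw by eventually_elim (use UB M in \<open>auto simp: abs_mult intro!: mult_mono\<close>)
    qed
    have "\<bar>P.expectation U * P.expectation ?R\<bar> \<le> M * err"
      unfolding abs_mult
      using M iU iV iw UB Vw by (intro mult_mono P.abs_expectation_le) auto
    moreover have "P.expectation (\<lambda>\<omega>. w k \<omega> * w l \<omega>) = P.expectation (\<lambda>\<omega>. U \<omega> * w l \<omega>)"
      using Uw by (intro integral_cong_AE) (auto elim: eventually_mono)
    moreover have "P.expectation (w k) = P.expectation U"
      using Uw by (intro integral_cong_AE) (auto elim: eventually_mono)
    moreover have "P.expectation (\<lambda>\<omega>. U \<omega> * w l \<omega>) - P.expectation U * P.expectation (w l)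
      = (P.expectation (\<lambda>\<omega>. U \<omega> * V \<omega>) - P.expectation U * P.expectation V)
        + (P.expectation (\<lambda>\<omega>. U \<omega> * ?R \<omega>) - P.expectation U * P.expectation ?R)"
      using iUV iUw iV iw by (simp add: right_diff_distrib)
    ultimately have "\<bar>P.expectation (\<lambda>\<omega>. w k \<omega> * w l \<omega>) - P.expectation (w k) * P.expectation (w l)\<bar>
      \<le> 4 * M\<^sup>2 * power_decay A' \<gamma> (Suc p) + 2 * M * err"
      using cov_UV EUR by simp
    also have "\<dots> \<le> 4 * M\<^sup>2 * (A' * real (Suc p) powr (- \<beta>)) + 2 * M * (c' * real (Suc p) powr (- \<beta>))"
      unfolding err_def power_decay_def using M A' c' \<beta>
      by (intro add_mono mult_left_mono) (auto intro!: powr_mono mult_left_mono)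
    also have "\<dots> = (4 * M\<^sup>2 * A' + 2 * M * c') * real (Suc p) powr (- \<beta>)"
      by (simp add: algebra_simps)
    also have "\<dots> \<le> (4 * M\<^sup>2 * A' + 2 * M * c') * (3 powr \<beta> * real (Suc (l - k)) powr (- \<beta>))"
    proof (rule mult_left_mono)
      have "real (Suc p) powr (- \<beta>) \<le> (real (Suc (l - k)) / 3) powr (- \<beta>)"
      proof (rule powr_mono2')
        have "Suc (l - k) \<le> 3 * Suc p" unfolding p_def by presburger
        then have "real (Suc (l - k)) \<le> real (3 * Suc p)" by (simp only: of_nat_le_iff)
        then show "real (Suc (l - k)) / 3 \<le> real (Suc p)" by simp
      qed (use \<beta> in auto)
      also have "\<dots> = 3 powr \<beta> * real (Suc (l - k)) powr (- \<beta>)"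
        by (simp add: powr_divide powr_minus field_simps)
      finally show "real (Suc p) powr (- \<beta>) \<le> 3 powr \<beta> * real (Suc (l - k)) powr (- \<beta>)" .
    qed (use M A' c' in auto)
    finally show ?thesis by (simp add: D_def mult_ac)
  qed
  moreover have "D \<ge> 0" using M A' c' by (simp add: D_def)
  ultimately show "\<exists>D\<ge>0. \<forall>k l. k \<le> l \<longrightarrow>
      \<bar>P.expectation (\<lambda>\<omega>. w k \<omega> * w l \<omega>) - P.expectation (w k) * P.expectation (w l)\<bar>
        \<le> D * real (Suc (l - k)) powr (- \<beta>)" by blast
qed

text \<open>
  The second moment of a block of \<open>n\<close> centred increments is of order \<open>n ^ a\<close> with
  \<open>a = 2 - min 1 \<beta>\<close>; dividing the resulting almost sure bound by \<open>n\<close> leaves the power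
  \<open>a / 2 - 1 = - min 1 \<beta> / 2\<close>.
\<close>
proposition sigma_sq_deviation:
  assumes \<beta>: "\<beta> > 0" "\<beta> \<noteq> 1" "\<beta> \<le> \<psi> - 1" "\<beta> \<le> \<gamma>"
    and SA1: "SA1 P T \<mu> f (power_decay A \<psi>)" and SA2: "SA2 E P (power_decay A' \<gamma>)"
    and SA3: "SA3 P T \<mu> f (power_decay A \<psi>)" and "\<delta> > 0"
  shows "AE \<omega> in P. (\<lambda>n. sigma_sq T \<mu> f n \<omega> - (\<integral>\<omega>'. sigma_sq T \<mu> f n \<omega>' \<partial>P))
    \<in> O(\<lambda>n. real n powr (- min 1 \<beta> / 2) * ln (real n) powr (3 / 2 + \<delta>))"
proof -
  define w where "w = variance_increment T \<mu> f"
  define X where "X k \<omega> = w k \<omega> - P.expectation (w k)" for k \<omega>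
  note decay = increment_correlation_decay[OF \<beta>(1,3,4) SA1 SA2 SA3, folded w_def]
  obtain B where B: "\<And>k. AE \<omega> in P. \<bar>w k \<omega>\<bar> \<le> B" using decay(1) by blast
  obtain D where D: "D \<ge> 0" "\<And>k l. k \<le> l \<Longrightarrow>
      \<bar>P.expectation (\<lambda>\<omega>. w k \<omega> * w l \<omega>) - P.expectation (w k) * P.expectation (w l)\<bar>
        \<le> D * real (Suc (l - k)) powr (- \<beta>)" using decay(2) by blast
  have wM [measurable]: "w k \<in> borel_measurable P" for k
    unfolding w_def
    using measurable_from_subalg[OF subalgebra_coord_space variance_increment_measurable[of k k]] by auto
  have iw: "integrable P (w k)" for k
    using B[of k] by (intro P.integrable_const_bound[of _ B]) auto
  have iww: "integrable P (\<lambda>\<omega>. w k \<omega> * w l \<omega>)" for k l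
  proof (rule P.integrable_const_bound)
    show "AE \<omega> in P. norm (w k \<omega> * w l \<omega>) \<le> B * B"
      using B[of k] B[of l]
      by eventually_elim (simp add: abs_mult, intro mult_mono, auto)
  qed measurable
  have Xm: "X k \<in> borel_measurable P" for k
    unfolding X_def[abs_def] by measurable
  have X_bound: "AE \<omega> in P. \<bar>X k \<omega>\<bar> \<le> 2 * B" for k
    using B[of k]
  proof eventually_elim
    case (elim \<omega>)
    moreover have "\<bar>P.expectation (w k)\<bar> \<le> B" by (rule P.abs_expectation_le[OF iw B])
    ultimately show ?case unfolding X_def by linarith
  qed
  have corr: "\<bar>P.expectation (\<lambda>\<omega>. X k \<omega> * X l \<omega>)\<bar> \<le> D * real (Suc (l - k)) powr (- \<beta>)"
    if "k \<le> l" for k l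
  proof -
    have "P.expectation (\<lambda>\<omega>. X k \<omega> * X l \<omega>)
      = P.expectation (\<lambda>\<omega>. w k \<omega> * w l \<omega> - P.expectation (w l) * w k \<omega>
          - P.expectation (w k) * w l \<omega> + P.expectation (w k) * P.expectation (w l))"
      by (intro Bochner_Integration.integral_cong refl) (simp add: X_def algebra_simps)
    also have "\<dots> = P.expectation (\<lambda>\<omega>. w k \<omega> * w l \<omega>) - P.expectation (w k) * P.expectation (w l)"
      using iw iww by (simp add: P.prob_space)
    finally show ?thesis using D(2)[OF that] by simp
  qed
  obtain c where c: "c \<ge> 0" "\<And>n. (\<Sum>d<n. real (Suc d) powr (- \<beta>)) \<le> c * real n powr (1 - min 1 \<beta>)"
    using sum_powr_decay_le[OF \<beta>(1,2)] by blast
  define a where "a = 2 - min 1 \<beta>"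
  note mom = P.second_moment_of_correlation_decay[where X = X and \<rho> = "\<lambda>d. D * real (Suc d) powr (- \<beta>)",
      OF Xm X_bound corr]
  have "AE \<omega> in P. (\<lambda>n. \<Sum>k<n. X k \<omega>) \<in> O(\<lambda>n. real n powr (a / 2) * ln (real n) powr (3 / 2 + \<delta>))"
  proof (rule P.gal_koksma)
    show "integrable P (\<lambda>\<omega>. (\<Sum>k=m..<m+n. X k \<omega>)\<^sup>2)" for m n
      by (rule mom(1))
    show "P.expectation (\<lambda>\<omega>. (\<Sum>k=m..<m+n. X k \<omega>)\<^sup>2) \<le> 2 * D * c * real n powr a" for m n
    proof -
      have "P.expectation (\<lambda>\<omega>. (\<Sum>k=m..<m+n. X k \<omega>)\<^sup>2)
        \<le> 2 * real n * (\<Sum>d<n. D * real (Suc d) powr (- \<beta>))" by (rule mom(2))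
      also have "\<dots> = 2 * real n * D * (\<Sum>d<n. real (Suc d) powr (- \<beta>))"
        by (simp add: sum_distrib_left mult.assoc)
      also have "\<dots> \<le> 2 * real n * D * (c * real n powr (1 - min 1 \<beta>))"
        using c(2)[of n] D(1) by (intro mult_left_mono) auto
      also have "\<dots> = 2 * D * c * real n powr a"
        using powr_add[of "real n" 1 "1 - min 1 \<beta>"] by (simp add: a_def)
      finally show ?thesis .
    qed
  qed (use \<open>\<delta> > 0\<close> in \<open>auto simp: a_def\<close>)
  then show ?thesis
  proof eventually_elim
    case (elim \<omega>)
    have "sigma_sq T \<mu> f n \<omega> - (\<integral>\<omega>'. sigma_sq T \<mu> f n \<omega>' \<partial>P) = (1 / real n) * (\<Sum>k<n. X k \<omega>)" for n
      using iw unfolding sigma_sq_eq_increments w_def[symmetric] X_def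
      by (simp add: sum_subtractf diff_divide_distrib)
    moreover have "(\<lambda>n. (1 / real n) * (\<Sum>k<n. X k \<omega>))
      \<in> O(\<lambda>n. (1 / real n) * (real n powr (a / 2) * ln (real n) powr (3 / 2 + \<delta>)))"
      by (rule landau_o.big.mult_left[OF elim])
    moreover have "(1 / real n) * (real n powr (a / 2) * ln (real n) powr (3 / 2 + \<delta>))
      = real n powr (- min 1 \<beta> / 2) * ln (real n) powr (3 / 2 + \<delta>)" for n
    proof (cases "n = 0")
      case False
      have "real n powr (a / 2) = real n powr 1 * real n powr (- min 1 \<beta> / 2)"
        unfolding powr_add[symmetric] a_def by (simp add: diff_divide_distrib)
      then show ?thesis using False by simp
    qed simp
    ultimately show ?case by simp
  qed
qed

end

section \<open>The deviation of the variance from its mean\<close>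

theorem theorem2p14:
  fixes E :: "'w measure" and P :: "(nat \<Rightarrow> 'w) measure"
    and T :: "'w \<Rightarrow> 'x \<Rightarrow> 'x" and \<mu> :: "'x measure" and f :: "'x \<Rightarrow> real"
    and A A' \<psi> \<gamma> \<delta> :: real
  assumes "random_dynamics E P T \<mu> f"
    and "\<psi> > 1" and "\<gamma> > 0"
    and "SA1 P T \<mu> f (power_decay A \<psi>)"
    and "SA2 E P (power_decay A' \<gamma>)"
    and "SA3 P T \<mu> f (power_decay A \<psi>)"
    and "\<delta> > 0"
  shows "AE \<omega> in P.
    (\<lambda>n. \<bar>sigma_sq T \<mu> f n \<omega> - (\<integral>\<omega>'. sigma_sq T \<mu> f n \<omega>' \<partial>P)\<bar>) \<in>
      O(\<lambda>n. if min (\<psi> - 1) \<gamma> > 1 then real n powr (- 1 / 2) * ln (real n) powr (3 / 2 + \<delta>)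
             else if min (\<psi> - 1) \<gamma> = 1 then real n powr (- 1 / 2 + \<delta>)
             else real n powr (- min (\<psi> - 1) \<gamma> / 2) * ln (real n) powr (3 / 2 + \<delta>))"
proof -
  let ?m = "min (\<psi> - 1) \<gamma>"
  note deviation = random_dynamics.sigma_sq_deviation[OF assms(1) _ _ _ _ assms(4-6)]
  show ?thesis
  proof (cases "?m = 1")
    case False
    have "AE \<omega> in P. (\<lambda>n. sigma_sq T \<mu> f n \<omega> - (\<integral>\<omega>'. sigma_sq T \<mu> f n \<omega>' \<partial>P))
      \<in> O(\<lambda>n. real n powr (- min 1 ?m / 2) * ln (real n) powr (3 / 2 + \<delta>))"
      by (rule deviation) (use assms False in auto)
    then show ?thesis
    proof eventually_elim
      case (elim \<omega>)
      show ?case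
      proof (cases "?m > 1")
        case True
        then have "min 1 ?m = 1" by simp
        with elim show ?thesis
          by (simp only: True if_True landau_o.big.abs_in_iff)
      next
        case less: False
        then have "min 1 ?m = ?m" by (intro min.absorb2) (simp only: not_less)
        with elim show ?thesis
          by (simp only: less False if_False landau_o.big.abs_in_iff)
      qed
    qed
  next
    case True
    \<comment> \<open>In the critical case the decay rate is lowered slightly to \<open>1 - \<epsilon>\<close>.  The rate obtained is then\<close>
    \<comment> \<open>\<open>n ^ (- 1 / 2 + \<epsilon> / 2)\<close> up to a power of the logarithm, which the remaining \<open>\<epsilon> / 2\<close> absorbs.\<close>
    define \<epsilon> where "\<epsilon> = min \<delta> (1 / 2)"
    have \<epsilon>: "0 < \<epsilon>" "\<epsilon> < 1" "\<epsilon> \<le> \<delta>" using assms(7) by (auto simp: \<epsilon>_def)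
    have "AE \<omega> in P. (\<lambda>n. sigma_sq T \<mu> f n \<omega> - (\<integral>\<omega>'. sigma_sq T \<mu> f n \<omega>' \<partial>P))
      \<in> O(\<lambda>n. real n powr (- min 1 (1 - \<epsilon>) / 2) * ln (real n) powr (3 / 2 + 1 / 2))"
      by (rule deviation) (use \<epsilon> True in \<open>auto simp: min_def split: if_splits\<close>)
    then show ?thesis
    proof eventually_elim
      case (elim \<omega>)
      have "(\<lambda>n. real n powr (- min 1 (1 - \<epsilon>) / 2) * ln (real n) powr (3 / 2 + 1 / 2))
        \<in> O(\<lambda>n. real n powr (- 1 / 2 + \<delta>))"
      proof (rule bigoI[where c = "(4 / \<epsilon>) powr 2"], rule eventually_sequentiallyI)
        fix n :: nat assume n: "n \<ge> 1"
        have "ln (real n) powr 2 \<le> (real n powr (\<epsilon> / 4) / (\<epsilon> / 4)) powr 2"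
          using n \<epsilon> by (intro powr_mono2 ln_powr_bound) auto
        also have "\<dots> = (4 / \<epsilon>) powr 2 * real n powr (\<epsilon> / 2)"
          using \<epsilon> by (simp add: powr_divide powr_powr powr_mult)
        finally have "real n powr (- (1 - \<epsilon>) / 2) * ln (real n) powr 2
          \<le> real n powr (- (1 - \<epsilon>) / 2) * ((4 / \<epsilon>) powr 2 * real n powr (\<epsilon> / 2))"
          by (intro mult_left_mono) auto
        also have "\<dots> = (4 / \<epsilon>) powr 2 * real n powr (- 1 / 2 + \<epsilon>)"
          by (simp add: field_simps flip: powr_add)
        also have "\<dots> \<le> (4 / \<epsilon>) powr 2 * real n powr (- 1 / 2 + \<delta>)"
          using n \<epsilon> by (intro mult_left_mono powr_mono) auto
        finally show "norm (real n powr (- min 1 (1 - \<epsilon>) / 2) * ln (real n) powr (3 / 2 + 1 / 2))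
          \<le> (4 / \<epsilon>) powr 2 * norm (real n powr (- 1 / 2 + \<delta>))"
          using \<epsilon> by (simp add: min_def)
      qed
      with elim have "(\<lambda>n. sigma_sq T \<mu> f n \<omega> - (\<integral>\<omega>'. sigma_sq T \<mu> f n \<omega>' \<partial>P))
        \<in> O(\<lambda>n. real n powr (- 1 / 2 + \<delta>))"
        by (rule landau_o.big_trans)
      then show ?case using True by simp
    qed
  qed
qed

end
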